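(* Let $N,m\ge 0$ be integers and, with the convention $\zeta(1):=\gamma$ (Euler's constant), put $$\Gamma_{N+1,m}:=\lim_{z\to N+1}\Big(\frac{d}{dz}\Big)^m\frac1{\Gamma(-z)}.$$ Then $$\frac1{2\pi i}\int_{\mathcal H}(\log w)^m w^{N+1}e^w\,dw=\Gamma_{N+1,m}$$ $$=(-1)^N\sum_{\substack{i+j+k=m\\ i\text{ odd}}}(-1)^{\frac{i-1}2}\,k!\binom{m}{i,j,k}\pi^{i-1}\,Y_j\big(-0!\,\zeta(1),\,1!\,\zeta(2),\dots,(j-1)!(-1)^j\zeta(j)\big)\,c(N+2,k+1),$$ the sum being over non-negative integers $i,j,k$. Moreover, for every $0<c^-<c$, $$\frac1{2\pi i}\int_{\mathcal H(x)}(\log w)^m w^{N+1}e^w\,dw=\Gamma_{N+1,m}+O_{N+1,m}\Big(\exp\Big(\frac{-c^-\log x}{\log T}\Big)\Big).$$ In particular, $\Gamma_{N,m}\in\mathbb Q(\gamma,\zeta(2),\dots,\zeta(m-1))$ for $N\ge1$.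
   Context: $c>0$ is a fixed constant and $T=T(x)>1$ is a function of $x$ (defined for $x\geq 1.9$) with $\log x/\log T\to\infty$ as $x\to\infty$. $\mathcal C(x)$ is the contour, traversed counterclockwise around $s=1$ from the lower to the upper half-plane, composed of the horizontal segments connecting $1-\frac c{\log T}\pm\frac i{\log x}$ to $1\pm\frac i{\log x}$ and the semicircle $\{1+\frac{e^{i\theta}}{\log x}:-\frac\pi2\le\theta\le\frac\pi2\}$. $\mathcal H(x)$ is its image under $s=1+\frac w{\log x}$, i.e. the horizontal segments connecting $-\frac{c\log x}{\log T}\pm i$ to $\pm i$ together with the semicircle $\{e^{i\theta}:-\frac\pi2\le\theta\le\frac\pi2\}$; $\mathcal H=\lim_{x\to\infty}\mathcal H(x)$ is the resulting Hankel contour (horizontal rays from $-\infty\pm i$ to $\pm i$ and the same semicircle, coming from $-\infty-i$ and going to $-\infty+i$). $\log w$ is the principal branch on $\mathbb C\setminus(-\infty,0]$. $Y_j(x_1,\dots,x_j)$ is the complete exponential Bell polynomial, defined by $\exp\big(\sum_{n\ge1}x_n\frac{t^n}{n!}\big)=\sum_{j\ge0}Y_j(x_1,\dots,x_j)\frac{t^j}{j!}$ (so $Y_0=1$); in the formula its $n$-th argument is $(n-1)!(-1)^n\zeta(n)$. $c(m,n)$ is the unsigned Stirling number of the first kind. $\binom{m}{i,j,k}=\frac{m!}{i!\,j!\,k!}$. The implied constant may also depend on the fixed $c,c^-$. The field in the last assertion is generated over $\mathbb Q$ by $\gamma=\zeta(1)$ and $\zeta(n)$, $2\le n\le m-1$,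 that is, by $\zeta(n)$ with $1\le n\le m-1$. *)

theory Defs
  imports
    "HOL-Complex_Analysis.Complex_Analysis"
    "HOL-Combinatorics.Stirling"
    "HOL-Algebra.Generated_Fields"
    "HOL-Algebra.Algebraic_Closure_Type"
begin

definition Gamma_coeff :: "nat \<Rightarrow> nat \<Rightarrow> complex"
  where "Gamma_coeff n m = Lim (at (of_nat n)) ((deriv ^^ m) (\<lambda>z. 1 / Gamma (- z)))"

text \<open>
  The values \<open>\<zeta>(n)\<close> for \<open>n \<ge> 1\<close>, with the convention \<open>\<zeta>(1) = \<gamma>\<close>;
  the value at \<open>n = 0\<close> is junk and never used.
\<close>
definition zeta_val :: "nat \<Rightarrow> real"
  where "zeta_val n = (if n = 1 then euler_mascheroni else (\<Sum>k. 1 / real (Suc k) ^ n))"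

text \<open>
  \<open>bell_Y j x\<close> is \<open>Y\<^sub>j(x\<^sub>1, \<dots>, x\<^sub>j)\<close>, read off from
  \<open>exp (\<Sum>n\<ge>1. x\<^sub>n t\<^sup>n / n!) = \<Sum>j. Y\<^sub>j t\<^sup>j / j!\<close>. The arguments are
  passed as a sequence, of which only the entries with index \<open>1, \<dots>, j\<close> matter.
\<close>
definition bell_Y :: "nat \<Rightarrow> (nat \<Rightarrow> 'a :: field_char_0) \<Rightarrow> 'a"
  where "bell_Y j x =
    fact j * fps_nth (fps_exp 1 oo Abs_fps (\<lambda>n. if n = 0 then 0 else x n / fact n)) j"

text \<open>
  The Hankel contour from \<open>-\<infinity> - \<i>\<close> to \<open>-\<infinity> + \<i>\<close>, parametrised by arc length over
  the whole real line. The rays are tangent to the semicircle at \<open>\<plusminus>\<i>\<close>, so this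
  parametrisation is continuously differentiable.
\<close>
definition hankel :: "real \<Rightarrow> complex"
  where "hankel t =
    (if t < - pi / 2 then of_real (t + pi / 2) - \<i>
     else if t \<le> pi / 2 then exp (\<i> * of_real t)
     else of_real (pi / 2 - t) + \<i>)"

text \<open>
  \<^const>\<open>contour_integral\<close> only covers paths over \<open>[0, 1]\<close>, so the integral over the infinite
  contour is written as a Lebesgue integral over the parameter.
\<close>
definition hankel_integrable :: "(complex \<Rightarrow> complex) \<Rightarrow> bool"
  where "hankel_integrable f \<longleftrightarrow>
    integrable lborel (\<lambda>t. f (hankel t) * vector_derivative hankel (at t))"

definition hankel_integral :: "(complex \<Rightarrow> complex) \<Rightarrow> complex"
  where "hankel_integral f =
    (\<integral>t. f (hankel t) * vector_derivative hankel (at t) \<partial>lborel)"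

text \<open>
  The Hankel contour truncated at real part \<open>-R\<close>. The contour \<open>\<H>(x)\<close> is the case
  \<open>R = c * ln x / ln (T x)\<close>.
\<close>
definition hankel_trunc :: "real \<Rightarrow> real \<Rightarrow> complex"
  where "hankel_trunc R =
    linepath (- of_real R - \<i>) (- \<i>) +++
    part_circlepath 0 1 (- pi / 2) (pi / 2) +++
    linepath \<i> (- of_real R + \<i>)"

text \<open>
  \<open>\<rat>(S)\<close> as a subfield of \<open>\<complex>\<close>; \<^const>\<open>ring_of_type_algebra\<close> is the field of complex
  numbers as a ring record.
\<close>
definition rat_adjoin :: "complex set \<Rightarrow> complex set"
  where "rat_adjoin S = generate_field ring_of_type_algebra (\<rat> \<union> S)"

end

theory Submission
  imports Defs "HOL-Real_Asymp.Real_Asymp"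
begin

text \<open>
  The function \<open>1 / \<Gamma>(-z)\<close> is entire, so \<open>Gamma_coeff n m\<close> is simply its \<open>m\<close>-th derivative at \<open>n\<close>, that is,
  \<open>m!\<close> times a Taylor coefficient. All claims are statements about these coefficients.

  For the closed formula, put \<open>z = N + 1 + t\<close>. The reflection formula and the functional equation of Gamma give
  \<open>1 / \<Gamma>(-z) = (-1)^N * (sin (pi t) / pi) * \<Gamma>(1 + t) * (t + 1) \<cdots> (t + N + 1)\<close>
  (\<open>rGamma_eq_near_nat\<close>). The Taylor coefficients of the sine vanish for even exponents; those of the last product are
  Stirling numbers; and \<open>\<Gamma>(1 + t)\<close> has the digamma function as its logarithmic derivative, so its coefficients are Bell
  polynomials in the zeta values (\<open>Gamma_has_fps_expansion_at_1\<close>). Multiplying the three power series yields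
  \<open>Gamma_coeff_eq_sum\<close>. The membership in the field generated by zeta values is read off from this formula:
  only even powers of \<open>pi\<close> occur, and these are rational multiples of powers of \<open>\<zeta>(2)\<close>.

  For the integral, the basic case is Hankel's formula
  \<open>\<integral> w powr z * exp w = 2 pi \<i> / \<Gamma>(-z)\<close> for \<open>Re z > 0\<close>. By symmetry under complex conjugation only the upper half of
  the contour has to be considered. There, Cauchy's theorem in the closed upper half-plane moves it to the real axis, where
  Euler's integral for \<open>\<Gamma>(z + 1)\<close> appears with the factor \<open>exp (\<i> pi z)\<close>
  (\<open>upper_half_hankel_Cauchy\<close>). The two halves combine to \<open>sin (pi z) * \<Gamma>(z + 1)\<close> and hence, by reflection, to
  \<open>1 / \<Gamma>(-z)\<close>.

  Powers of the logarithm enter by expanding \<open>w powr (n + t)\<close> in powers of \<open>t\<close>: the integral of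
  \<open>(log w)^m * w^n * exp w\<close> is \<open>m!\<close> times the coefficient of \<open>t^m\<close> in the integral of \<open>w powr (n + t) * exp w\<close>
  (\<open>hankel_integral_log_power_exp_sums\<close>). Comparing with the Taylor series of \<open>1 / \<Gamma>(-z)\<close> at \<open>n\<close> evaluates it. Finally, the
  integrands decay exponentially along the rays, at every rate below 1, and this bounds the error made by truncating the
  contour.
\<close>

section \<open>Complete exponential Bell polynomials\<close>

lemma bell_Y_0 [simp]: "bell_Y 0 x = 1"
  by (simp add: bell_Y_def)

lemma fps_deriv_exp_compose_egf:
  fixes x :: "nat \<Rightarrow> 'a :: field_char_0"
  defines "E \<equiv> fps_exp 1 oo Abs_fps (\<lambda>n. if n = 0 then 0 else x n / fact n)"
  shows "fps_deriv E = E * Abs_fps (\<lambda>n. x (Suc n) / fact n)"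
proof -
  define A where "A = Abs_fps (\<lambda>n. if n = 0 then 0 else x n / fact n)"
  have "fps_deriv A = Abs_fps (\<lambda>n. x (Suc n) / fact n)"
    by (simp add: A_def fps_eq_iff field_simps del: of_nat_Suc)
  moreover have "fps_deriv E = E * fps_deriv A"
    unfolding E_def A_def [symmetric] by (subst fps_compose_deriv) (simp_all add: A_def)
  ultimately show ?thesis by simp
qed

text \<open>
  The coefficientwise form of the differential equation \<open>E' = E A'\<close> for \<open>E = exp A\<close>. This
  recursion, rather than the power series composition, is what the later arguments use: it shows
  that \<open>bell_Y\<close> is built from its arguments by rational operations, and it determines a power
  series with a known logarithmic derivative.
\<close>

lemma bell_Y_Suc:
  fixes x :: "nat \<Rightarrow> 'a :: field_char_0"
  shows "bell_Y (Suc n) x = (\<Sum>i\<le>n. of_nat (n choose i) * bell_Y i x * x (Suc (n - i)))"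
proof -
  define E where "E = fps_exp 1 oo Abs_fps (\<lambda>n. if n = 0 then 0 else x n / fact n)"
  have E: "fps_nth E i = bell_Y i x / fact i" for i
    by (simp add: bell_Y_def E_def)
  have "of_nat (Suc n) * fps_nth E (Suc n) = fps_nth (fps_deriv E) n"
    by simp
  also have "fps_deriv E = E * Abs_fps (\<lambda>n. x (Suc n) / fact n)"
    unfolding E_def by (rule fps_deriv_exp_compose_egf)
  also have "fps_nth \<dots> n = (\<Sum>i\<le>n. bell_Y i x / fact i * (x (Suc (n - i)) / fact (n - i)))"
    by (simp add: fps_mult_nth E atLeast0AtMost)
  finally have "bell_Y (Suc n) x =
      fact n * (\<Sum>i\<le>n. bell_Y i x / fact i * (x (Suc (n - i)) / fact (n - i)))"
    by (simp add: E field_simps del: of_nat_Suc)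
  also have "\<dots> = (\<Sum>i\<le>n. of_nat (n choose i) * bell_Y i x * x (Suc (n - i)))"
    by (simp add: sum_distrib_left binomial_fact mult_ac)
  finally show ?thesis .
qed

lemma bell_Y_of_real:
  "bell_Y n (\<lambda>k. of_real (x k) :: 'a :: {real_field, field_char_0}) = of_real (bell_Y n x)"
proof (induction n rule: less_induct)
  case (less n)
  show ?case
  proof (cases n)
    case (Suc n')
    then show ?thesis
      using less.IH by (simp add: bell_Y_Suc)
  qed simp
qed

text \<open>
  A power series with constant term 1 is determined by its logarithmic derivative. The coefficient
  of the latter in degree \<open>n\<close> is written as \<open>x (Suc n) / n!\<close> because \<open>log F\<close> then is the
  exponential generating function of \<open>x\<close>.
\<close>

lemma fps_log_deriv_eq_imp_bell_Y:
  fixes F :: "'a :: field_char_0 fps"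
  assumes "fps_nth F 0 = 1" "fps_deriv F = F * Abs_fps (\<lambda>n. x (Suc n) / fact n)"
  shows "fps_nth F n = bell_Y n x / fact n"
proof (induction n rule: less_induct)
  case (less n)
  show ?case
  proof (cases n)
    case 0
    then show ?thesis using assms(1) by simp
  next
    case (Suc n')
    have "of_nat (Suc n') * fps_nth F (Suc n') = fps_nth (fps_deriv F) n'"
      by simp
    also have "\<dots> = (\<Sum>i\<le>n'. fps_nth F i * (x (Suc (n' - i)) / fact (n' - i)))"
      unfolding assms(2) by (simp add: fps_mult_nth atLeast0AtMost)
    also have "\<dots> = (\<Sum>i\<le>n'. bell_Y i x / fact i * (x (Suc (n' - i)) / fact (n' - i)))"
      using less.IH Suc by (intro sum.cong) auto
    also have "\<dots> = bell_Y (Suc n') x / fact n'"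
      by (simp add: bell_Y_Suc sum_divide_distrib binomial_fact field_simps)
    finally show ?thesis
      by (simp add: Suc field_simps del: of_nat_Suc)
  qed
qed

section \<open>Taylor coefficients of the reciprocal Gamma function\<close>

text \<open>
  The convention \<open>zeta_val 1 = euler_mascheroni\<close> is what makes the case \<open>n = 0\<close> fit the general
  pattern, since the digamma function takes the value \<open>- euler_mascheroni\<close> at 1.
\<close>

lemma Polygamma_at_1:
  "Polygamma n (1 :: complex) = fact n * (-1) ^ Suc n * of_real (zeta_val (Suc n))"
proof (cases "n = 0")
  case True
  then show ?thesis by (simp add: zeta_val_def)
next
  case False
  have s: "(\<lambda>k. 1 / real (Suc k) ^ Suc n) sums (\<Sum>k. 1 / real (Suc k) ^ Suc n)"
  proof (intro summable_sums)
    have "summable (\<lambda>k. inverse (real k ^ Suc n))"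
      using inverse_power_summable[of "Suc n", where ?'a = real] False by simp
    then show "summable (\<lambda>k. 1 / real (Suc k) ^ Suc n)"
      by (subst (asm) summable_Suc_iff [symmetric]) (simp add: inverse_eq_divide)
  qed
  have "(\<lambda>k. inverse ((1 + of_nat k :: complex) ^ Suc n)) sums of_real (\<Sum>k. 1 / real (Suc k) ^ Suc n)"
    using sums_of_real[OF s, where ?'a = complex] by (simp add: inverse_eq_divide)
  moreover have "(\<lambda>k. inverse ((1 + of_nat k :: complex) ^ Suc n)) sums
      ((-1) ^ Suc n * Polygamma n 1 / fact n)"
    using Polygamma_LIMSEQ[of "1::complex" n] False by simp
  ultimately have "(-1) ^ Suc n * Polygamma n 1 / fact n = complex_of_real (zeta_val (Suc n))"
    using False by (simp add: zeta_val_def sums_iff)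
  then have "(-1) ^ Suc n * ((-1) ^ Suc n * Polygamma n 1) = fact n * (-1) ^ Suc n * complex_of_real (zeta_val (Suc n))"
    by (simp add: field_simps)
  then show ?thesis
    by (simp flip: mult.assoc power_add)
qed

lemma eventually_one_plus_not_nonpos_Ints:
  "eventually (\<lambda>t::complex. 1 + t \<notin> \<int>\<^sub>\<le>\<^sub>0) (nhds 0)"
proof -
  have "eventually (\<lambda>t::complex. t \<in> ball 0 1) (nhds 0)"
    by (intro eventually_nhds_in_open) auto
  then show ?thesis
  proof eventually_elim
    case (elim t)
    then have "\<bar>Re t\<bar> < 1" using abs_Re_le_cmod[of t] by auto
    then show ?case by (auto elim!: nonpos_Ints_cases simp: complex_eq_iff)
  qed
qed

text \<open>
  The logarithmic derivative of \<open>\<Gamma> (1 + t)\<close> is the digamma function, whose Taylor coefficients at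
  1 are polygamma values and hence zeta values.
\<close>

lemma Gamma_has_fps_expansion_at_1:
  "(\<lambda>t. Gamma (1 + t)) has_fps_expansion
     Abs_fps (\<lambda>n. complex_of_real (bell_Y n (\<lambda>k. fact (k - 1) * (-1) ^ k * zeta_val k) / fact n))"
    (is "_ has_fps_expansion Abs_fps ?b")
proof -
  define x where "x = (\<lambda>k. fact (k - 1) * (-1) ^ k * zeta_val k :: real)"
  define F where "F = fps_expansion Gamma (1 :: complex)"
  note ev = eventually_one_plus_not_nonpos_Ints
  have F: "(\<lambda>t. Gamma (1 + t)) has_fps_expansion F"
    unfolding F_def by (intro analytic_at_imp_has_fps_expansion analytic_Gamma) auto
  have "(\<lambda>t. Digamma (1 + t)) has_fps_expansion fps_expansion Digamma (1::complex)"
    by (intro analytic_at_imp_has_fps_expansion analytic_on_Polygamma) auto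
  also have "fps_expansion Digamma (1::complex) = Abs_fps (\<lambda>n. of_real (x (Suc n)) / fact n)"
    by (simp add: fps_expansion_def higher_deriv_Polygamma Polygamma_at_1 x_def)
  finally have "(\<lambda>t. Gamma (1 + t) * Digamma (1 + t)) has_fps_expansion
      F * Abs_fps (\<lambda>n. of_real (x (Suc n)) / fact n)"
    by (intro fps_expansion_intros F)
  moreover have "eventually (\<lambda>t. deriv (\<lambda>t. Gamma (1 + t)) t = Gamma (1 + t) * Digamma (1 + t :: complex)) (nhds 0)"
    using ev by eventually_elim (auto intro!: DERIV_imp_deriv derivative_eq_intros)
  ultimately have "deriv (\<lambda>t. Gamma (1 + t)) has_fps_expansion
      F * Abs_fps (\<lambda>n. complex_of_real (x (Suc n)) / fact n)"
    by (subst has_fps_expansion_cong) auto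
  with has_fps_expansion_deriv[OF F] have ode: "fps_deriv F = F * Abs_fps (\<lambda>n. of_real (x (Suc n)) / fact n)"
    by (rule fps_expansion_unique_complex)
  have "fps_nth F 0 = 1"
    by (simp add: F_def fps_expansion_def)
  from fps_log_deriv_eq_imp_bell_Y[where x = "\<lambda>k. complex_of_real (x k)", OF this ode] have "fps_nth F n = complex_of_real (bell_Y n x) / fact n" for n
    by (simp only: bell_Y_of_real)
  then have "F = Abs_fps ?b"
    by (simp add: fps_eq_iff x_def)
  with F show ?thesis by simp
qed

text \<open>
  The identity \<open>stirling_pochhammer\<close> holds in every commutative semiring, so it may be evaluated
  at the formal variable itself. Cancelling one factor \<open>fps_X\<close> shifts both indices by one.
\<close>

lemma fps_nth_pochhammer_X_plus_1:
  "fps_nth (pochhammer (fps_X + 1 :: 'a :: idom fps) n) k = of_nat (stirling (Suc n) (Suc k))"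
proof -
  have "fps_X * pochhammer (fps_X + 1 :: 'a fps) n = pochhammer fps_X (Suc n)"
    by (simp add: pochhammer_rec)
  also have "\<dots> = (\<Sum>k\<le>Suc n. of_nat (stirling (Suc n) k) * fps_X ^ k)"
    by (rule stirling_pochhammer [symmetric])
  finally have "fps_nth (fps_X * pochhammer (fps_X + 1 :: 'a fps) n) (Suc k) =
      (\<Sum>j\<le>Suc n. if j = Suc k then of_nat (stirling (Suc n) j) else 0)"
    by (simp add: fps_sum_nth fps_of_nat [symmetric] fps_X_power_nth if_distrib eq_commute cong: if_cong del: sum.atMost_Suc)
  also have "\<dots> = of_nat (stirling (Suc n) (Suc k))"
    by (auto simp: not_le less_Suc_eq_le simp del: sum.atMost_Suc)
  finally show ?thesis by simp
qed

text \<open>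
  Reflection trades the reciprocal Gamma function near a non-positive integer for the Gamma
  function near 1: the sine carries the zero at \<open>t = 0\<close>, and the functional equation of Gamma
  contributes the Pochhammer symbol.
\<close>

lemma rGamma_eq_near_nat:
  fixes t :: complex
  assumes "1 + t \<notin> \<int>\<^sub>\<le>\<^sub>0"
  shows "rGamma (- (of_nat (N + 1) + t)) =
    (-1) ^ N / of_real pi * sin (of_real pi * t) * Gamma (1 + t) * pochhammer (t + 1) (N + 1)"
proof -
  define z where "z = - (of_nat (N + 1) + t)"
  have z: "1 - z = 1 + t + of_nat (N + 1)" by (simp add: z_def)
  have nz: "1 - z \<notin> \<int>\<^sub>\<le>\<^sub>0"
  proof
    assume "1 - z \<in> \<int>\<^sub>\<le>\<^sub>0"
    then have "1 - z - of_nat (N + 1) \<in> \<int>\<^sub>\<le>\<^sub>0"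
      by (rule nonpos_Ints_diff_Nats) auto
    then show False using assms by (simp add: z)
  qed
  have "Gamma (1 - z) = Gamma (1 + t) * pochhammer (1 + t) (N + 1)"
    using assms by (simp add: z pochhammer_Gamma Gamma_eq_zero_iff)
  moreover have "sin (of_real pi * z) = (-1) ^ N * sin (of_real pi * t)"
  proof -
    have "of_real pi * z = - (of_real pi * t + of_nat (N + 1) * of_real pi)"
      by (simp add: z_def algebra_simps)
    moreover have "complex_of_nat (N + 1) * of_real pi = of_real (real (Suc N) * pi)"
      by simp
    ultimately show ?thesis
      by (simp only: sin_minus sin_add sin_of_real cos_of_real sin_npi cos_npi) simp
  qed
  moreover have "rGamma z = sin (of_real pi * z) / of_real pi * Gamma (1 - z)"
  proof -
    have "Gamma (1 - z) \<noteq> 0" using nz by (simp add: Gamma_eq_zero_iff)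
    then have "rGamma z = rGamma z * rGamma (1 - z) * Gamma (1 - z)"
      by (simp add: rGamma_inverse_Gamma[of "1 - z"])
    then show ?thesis
      by (simp only: rGamma_reflection_complex)
  qed
  ultimately show ?thesis
    by (simp add: z_def add_ac)
qed

text \<open>
  At its poles \<open>\<Gamma>\<close> has the default value 0, so that its reciprocal there is \<open>1 / 0 = 0\<close>. This is
  the value of the entire function \<open>rGamma\<close>, so the equation holds everywhere and not only off the
  poles.
\<close>

lemma inverse_Gamma_minus_eq_rGamma: "(\<lambda>z. 1 / Gamma (- z)) = (\<lambda>z :: complex. rGamma (- z))"
  by (simp add: rGamma_inverse_Gamma inverse_eq_divide)

lemma tendsto_Gamma_coeff:
    "((deriv ^^ m) (\<lambda>z. 1 / Gamma (- z)) \<longlongrightarrow> Gamma_coeff n m) (at (of_nat n))"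
  and Gamma_coeff_eq_deriv: "Gamma_coeff n m = (deriv ^^ m) (\<lambda>z. rGamma (- z)) (of_nat n)"
proof -
  have "(deriv ^^ m) (\<lambda>z. rGamma (- z)) holomorphic_on UNIV"
    by (intro holomorphic_higher_deriv holomorphic_intros) auto
  then have "isCont ((deriv ^^ m) (\<lambda>z :: complex. rGamma (- z))) (of_nat n)"
    using holomorphic_on_imp_continuous_on continuous_on_eq_continuous_at open_UNIV by blast
  then have lim: "((deriv ^^ m) (\<lambda>z. 1 / Gamma (- z)) \<longlongrightarrow> (deriv ^^ m) (\<lambda>z. rGamma (- z)) (of_nat n)) (at (of_nat n :: complex))"
    by (simp add: isCont_def inverse_Gamma_minus_eq_rGamma)
  then show eq: "Gamma_coeff n m = (deriv ^^ m) (\<lambda>z. rGamma (- z)) (of_nat n)"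
    unfolding Gamma_coeff_def by (intro tendsto_Lim) auto
  with lim show "((deriv ^^ m) (\<lambda>z. 1 / Gamma (- z)) \<longlongrightarrow> Gamma_coeff n m) (at (of_nat n))"
    by simp
qed

lemma rGamma_has_fps_expansion_Gamma_coeff:
  "(\<lambda>t. rGamma (- (of_nat n + t))) has_fps_expansion Abs_fps (\<lambda>m. Gamma_coeff n m / fact m)"
proof -
  have "(\<lambda>t. rGamma (- (of_nat n + t))) has_fps_expansion fps_expansion (\<lambda>z. rGamma (- z)) (of_nat n)"
    by (rule analytic_at_imp_has_fps_expansion) (intro analytic_intros)
  then show ?thesis
    by (simp add: fps_expansion_def Gamma_coeff_eq_deriv)
qed

lemma finite_triples_sum_eq: "finite {(i, j, k). i + j + k = (m :: nat)}"
  by (rule finite_subset[of _ "{..m} \<times> {..m} \<times> {..m}"]) auto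

lemma fps_mult3_nth:
  fixes A B C :: "'a :: comm_semiring_1 fps"
  shows "fps_nth (A * B * C) m =
    (\<Sum>(i, j, k) \<in> {(i, j, k). i + j + k = m}. fps_nth A i * fps_nth B j * fps_nth C k)"
proof -
  have "fps_nth (A * B * C) m =
      (\<Sum>(l, i) \<in> (SIGMA l:{0..m}. {0..l}). fps_nth A i * fps_nth B (l - i) * fps_nth C (m - l))"
    by (simp add: fps_mult_nth sum_distrib_right sum.Sigma)
  also have "\<dots> = (\<Sum>(i, j, k) \<in> {(i, j, k). i + j + k = m}. fps_nth A i * fps_nth B j * fps_nth C k)"
    by (rule sum.reindex_bij_witness[where
          i = "\<lambda>(i, j, k). (i + j, i)" and j = "\<lambda>(l, i). (i, l - i, m - l)"]) auto
  finally show ?thesis .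
qed

lemma pochhammer_has_fps_expansion:
  "(\<lambda>t :: 'a :: {banach, real_normed_field}. pochhammer (t + 1) n) has_fps_expansion pochhammer (fps_X + 1) n"
proof (induction n)
  case (Suc n)
  have "(\<lambda>_ :: 'a. of_nat n) has_fps_expansion of_nat n"
    by (simp flip: fps_of_nat)
  then show ?case
    unfolding pochhammer_Suc by (intro fps_expansion_intros Suc)
qed simp

text \<open>
  The coefficient of \<open>t ^ m\<close> in the product of the three expansions. Indices \<open>i\<close>, \<open>j\<close>, \<open>k\<close> belong
  to the sine, to Gamma and to the Pochhammer symbol; the sine is odd, which leaves the odd \<open>i\<close>,
  and dividing it by \<open>pi\<close> lowers the exponent of \<open>pi\<close> to \<open>i - 1\<close>.
\<close>

lemma Gamma_coeff_eq_sum: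
  "Gamma_coeff (N + 1) m = complex_of_real
         ((- 1) ^ N *
          (\<Sum>(i, j, k) \<in> {(i, j, k). i + j + k = m \<and> odd i}.
             (- 1) ^ ((i - 1) div 2) * fact k * (fact m / (fact i * fact j * fact k)) *
             pi ^ (i - 1) *
             bell_Y j (\<lambda>n. fact (n - 1) * (- 1) ^ n * zeta_val n) *
             real (stirling (N + 2) (k + 1))))"
proof -
  define Y where "Y = (\<lambda>j. bell_Y j (\<lambda>n. fact (n - 1) * (- 1) ^ n * zeta_val n :: real))"
  define A where "A = fps_sin (complex_of_real pi)"
  define B where "B = Abs_fps (\<lambda>n. complex_of_real (Y n / fact n))"
  define C where "C = (pochhammer (fps_X + 1) (N + 1) :: complex fps)"
  let ?a = "\<lambda>i j k. (- 1) ^ ((i - 1) div 2) * fact k * (fact m / (fact i * fact j * fact k)) *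
             pi ^ (i - 1) * Y j * real (stirling (N + 2) (k + 1))"
  have ev: "eventually (\<lambda>t::complex. 1 + t \<notin> \<int>\<^sub>\<le>\<^sub>0) (nhds 0)"
    by (rule eventually_one_plus_not_nonpos_Ints)
  have "(\<lambda>t. (-1) ^ N / of_real pi * (sin (of_real pi * t) * Gamma (1 + t) * pochhammer (t + 1) (N + 1)))
      has_fps_expansion fps_const ((-1) ^ N / of_real pi) * (A * B * C)"
    unfolding A_def B_def C_def Y_def
    by (intro fps_expansion_intros Gamma_has_fps_expansion_at_1 pochhammer_has_fps_expansion)
  moreover have "eventually (\<lambda>t::complex. rGamma (- (of_nat (N + 1) + t)) =
      (-1) ^ N / of_real pi * (sin (of_real pi * t) * Gamma (1 + t) * pochhammer (t + 1) (N + 1))) (nhds 0)"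
    using ev by eventually_elim (subst rGamma_eq_near_nat, auto simp: mult_ac)
  ultimately have "(\<lambda>t. rGamma (- (of_nat (N + 1) + t)))
      has_fps_expansion fps_const ((-1) ^ N / of_real pi) * (A * B * C)"
    by (subst has_fps_expansion_cong) auto
  with rGamma_has_fps_expansion_Gamma_coeff[of "N + 1"]
  have "Abs_fps (\<lambda>m. Gamma_coeff (N + 1) m / fact m) = fps_const ((-1) ^ N / of_real pi) * (A * B * C)"
    by (rule fps_expansion_unique_complex)
  then have "fps_nth (Abs_fps (\<lambda>m. Gamma_coeff (N + 1) m / fact m)) m =
      fps_nth (fps_const ((-1) ^ N / of_real pi) * (A * B * C)) m"
    by (rule arg_cong)
  then have "Gamma_coeff (N + 1) m / fact m = (-1) ^ N / of_real pi * fps_nth (A * B * C) m"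
    by (simp only: fps_mult_left_const_nth fps_nth_Abs_fps)
  then have "Gamma_coeff (N + 1) m = (-1) ^ N * (fact m / of_real pi * fps_nth (A * B * C) m)"
    by (simp add: field_simps)
  also have "fact m / of_real pi * fps_nth (A * B * C) m =
      (\<Sum>(i, j, k) \<in> {(i, j, k). i + j + k = m}. if odd i then complex_of_real (?a i j k) else 0)"
    unfolding fps_mult3_nth sum_distrib_left
  proof (intro sum.cong refl, goal_cases)
    case (1 p)
    obtain i j k where p: "p = (i, j, k)" by (cases p)
    show ?case
    proof (cases "odd i")
      case True
      then obtain i' where "i = Suc i'" by (cases i) auto
      with True show ?thesis
        unfolding A_def B_def C_def fps_nth_pochhammer_X_plus_1
        by (simp add: fps_sin_def field_simps p del: stirling.simps fact_Suc)
    qed (simp add: p A_def fps_sin_def)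
  qed
  also have "\<dots> = (\<Sum>(i, j, k) \<in> {(i, j, k). i + j + k = m \<and> odd i}. complex_of_real (?a i j k))"
    by (rule sum.mono_neutral_cong_right) (use finite_triples_sum_eq in auto)
  finally show ?thesis
    by (simp add: Y_def case_prod_unfold)
qed

section \<open>Geometry of the Hankel contour\<close>

definition hankel_deriv :: "real \<Rightarrow> complex"
  where "hankel_deriv t =
    (if t \<le> pi / 2 then if t \<le> - pi / 2 then 1 else \<i> * cis t else - 1)"

lemma exp_half_pi_i [simp]:
  "exp (\<i> * of_real pi / 2) = \<i>" "exp (- (\<i> * of_real pi / 2)) = - \<i>"
  using cis_pi_half cis_minus_pi_half by (simp_all add: cis_conv_exp)

text \<open>
  The rays meet the semicircle tangentially, so each of the three formulas for the contour and for
  its derivative is valid on a closed parameter interval. Properties of the contour are proved by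
  going through these three intervals.
\<close>

lemma hankel_mid: "- pi / 2 \<le> t \<Longrightarrow> t \<le> pi / 2 \<Longrightarrow> hankel t = cis t"
  by (simp add: hankel_def flip: cis_conv_exp)

lemma hankel_left:
  assumes "t \<le> - pi / 2"
  shows "hankel t = of_real (t + pi / 2) - \<i>"
proof (cases "t = - pi / 2")
  case False
  then show ?thesis using assms by (simp add: hankel_def)
qed (simp add: hankel_mid)

lemma hankel_right:
  assumes "pi / 2 \<le> t"
  shows "hankel t = of_real (pi / 2 - t) + \<i>"
proof (cases "t = pi / 2")
  case False
  then have "\<not> t < - pi / 2" "\<not> t \<le> pi / 2" using assms pi_gt_zero by linarith+
  then show ?thesis by (simp add: hankel_def)
next
  case True
  show ?thesis unfolding True by (simp add: hankel_mid)
qed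

lemma hankel_deriv_left:
  assumes "t \<le> - pi / 2"
  shows "hankel_deriv t = 1"
proof -
  have "t \<le> pi / 2" using assms pi_gt_zero by linarith
  then show ?thesis using assms by (simp add: hankel_deriv_def)
qed

lemma hankel_deriv_mid: "- pi / 2 \<le> t \<Longrightarrow> t \<le> pi / 2 \<Longrightarrow> hankel_deriv t = \<i> * cis t"
  by (cases "t = - pi / 2") (auto simp: hankel_deriv_def)

lemma hankel_deriv_right:
  assumes "pi / 2 \<le> t"
  shows "hankel_deriv t = - 1"
proof (cases "t = pi / 2")
  case True
  show ?thesis unfolding True by (simp add: hankel_deriv_mid)
qed (use assms in \<open>simp add: hankel_deriv_def\<close>)

lemma hankel_cases:
  obtains (left) "t \<le> - pi / 2" | (mid) "- pi / 2 \<le> t" "t \<le> pi / 2" | (right) "pi / 2 \<le> t"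
  by linarith

lemma hankel_has_vector_derivative: "(hankel has_vector_derivative hankel_deriv t) (at t)"
proof -
  have left: "((\<lambda>t. of_real (t + pi / 2) - \<i>) has_vector_derivative 1) (at t within A)" for t A
    by (auto intro!: derivative_eq_intros)
  have mid: "(cis has_vector_derivative \<i> * cis t) (at t within A)" for t A
    by (auto simp: has_vector_derivative_def intro!: derivative_eq_intros)
  have right: "((\<lambda>t. of_real (pi / 2 - t) + \<i>) has_vector_derivative - 1) (at t within A)" for t A
    by (auto intro!: derivative_eq_intros)
  define h1 where "h1 = (\<lambda>t. if t \<in> {..- pi / 2} then of_real (t + pi / 2) - \<i> else cis t)"
  define d1 where "d1 = (\<lambda>t. if t \<in> {..- pi / 2} then 1 else \<i> * cis t)"
  have 1: "(h1 has_vector_derivative d1 t) (at t)" for t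
    unfolding h1_def d1_def
    by (rule has_vector_derivative_If_within_closures[where T = "{- pi / 2<..}"])
       (use left mid in \<open>auto simp: complex_eq_iff\<close>)
  have "((\<lambda>t. if t \<in> {..pi / 2} then h1 t else of_real (pi / 2 - t) + \<i>) has_vector_derivative
      (if t \<in> {..pi / 2} then d1 t else - 1)) (at t)"
  proof (rule has_vector_derivative_If_within_closures[where T = "{pi / 2<..}"])
    assume "t \<in> closure {..pi / 2}" "t \<in> closure {pi / 2<..}"
    then have t: "t = pi / 2" by simp
    have "\<not> pi / 2 \<le> - pi / 2" using pi_gt_zero by linarith
    then show "h1 t = of_real (pi / 2 - t) + \<i>" "d1 t = - 1"
      unfolding t by (simp_all add: h1_def d1_def)
  qed (use right has_vector_derivative_at_within[OF 1] in auto)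
  moreover have "(\<lambda>t. if t \<in> {..pi / 2} then h1 t else of_real (pi / 2 - t) + \<i>) = hankel"
  proof
    fix t show "(if t \<in> {..pi / 2} then h1 t else of_real (pi / 2 - t) + \<i>) = hankel t"
    proof (cases "t \<le> - pi / 2")
      case True
      then have "t \<le> pi / 2" using pi_gt_zero by linarith
      then show ?thesis using True by (simp add: h1_def hankel_left)
    next
      case False
      then show ?thesis by (cases "t \<le> pi / 2") (simp_all add: h1_def hankel_mid hankel_right)
    qed
  qed
  moreover have "(if t \<in> {..pi / 2} then d1 t else - 1) = hankel_deriv t"
    by (simp add: d1_def hankel_deriv_def)
  ultimately show ?thesis by simp
qed

lemma continuous_on_hankel [continuous_intros]: "continuous_on A hankel"
  by (meson continuous_at_imp_continuous_on has_vector_derivative_continuous hankel_has_vector_derivative)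

lemma continuous_on_hankel_deriv [continuous_intros]: "continuous_on A hankel_deriv"
proof -
  have 1: "continuous_on UNIV (\<lambda>t :: real. if t \<le> - pi / 2 then 1 else \<i> * cis t)"
    by (intro continuous_on_cases_le continuous_intros) (auto simp: complex_eq_iff)
  have "continuous_on UNIV hankel_deriv"
    unfolding hankel_deriv_def [abs_def]
  proof (intro continuous_on_cases_le continuous_intros continuous_on_subset[OF 1])
    fix t :: real assume "t = pi / 2"
    then show "(if t \<le> - pi / 2 then 1 else \<i> * cis t) = - 1"
      using hankel_deriv_right[of t] by (simp add: hankel_deriv_def)
  qed auto
  then show ?thesis by (rule continuous_on_subset) auto
qed

lemma hankel_minus: "hankel (- t) = cnj (hankel t)"
  by (cases t rule: hankel_cases) (simp_all add: hankel_left hankel_mid hankel_right complex_eq_iff)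

lemma hankel_deriv_minus: "hankel_deriv (- t) = - cnj (hankel_deriv t)"
  by (cases t rule: hankel_cases)
     (simp_all add: hankel_deriv_left hankel_deriv_mid hankel_deriv_right complex_eq_iff)

lemma norm_hankel_deriv [simp]: "norm (hankel_deriv t) = 1"
  by (simp add: hankel_deriv_def norm_mult)

lemma hankel_not_nonpos_Real: "hankel t \<notin> \<real>\<^sub>\<le>\<^sub>0"
proof (cases t rule: hankel_cases)
  case mid
  have "cos t \<ge> 0" using mid by (intro cos_ge_zero) auto
  moreover have "cos t ^ 2 + sin t ^ 2 = 1" by simp
  ultimately have "\<not> (cos t \<le> 0 \<and> sin t = 0)" by (auto simp del: sin_cos_squared_add2)
  then show ?thesis using mid by (simp add: hankel_mid complex_nonpos_Reals_iff)
qed (simp_all add: hankel_left hankel_right complex_nonpos_Reals_iff)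

lemma norm_hankel_ge_1: "1 \<le> norm (hankel t)"
proof (cases t rule: hankel_cases)
  case left
  then show ?thesis using abs_Im_le_cmod[of "hankel t"] by (simp add: hankel_left)
next
  case right
  then show ?thesis using abs_Im_le_cmod[of "hankel t"] by (simp add: hankel_right)
qed (simp add: hankel_mid)

lemma norm_hankel_le: "norm (hankel t) \<le> 1 + \<bar>t\<bar>"
proof (cases t rule: hankel_cases)
  case left
  have "norm (hankel t) \<le> norm (of_real (t + pi / 2) :: complex) + norm \<i>"
    unfolding hankel_left[OF left] by (rule norm_triangle_ineq4)
  then show ?thesis using left pi_gt_zero by (simp only: norm_of_real norm_ii; linarith)
next
  case right
  have "norm (hankel t) \<le> norm (of_real (pi / 2 - t) :: complex) + norm \<i>"
    unfolding hankel_right[OF right] by (rule norm_triangle_ineq)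
  then show ?thesis using right pi_gt_zero by (simp only: norm_of_real norm_ii; linarith)
qed (simp add: hankel_mid)

lemma Re_hankel_le: "Re (hankel t) \<le> pi / 2 + 1 - \<bar>t\<bar>"
proof (cases t rule: hankel_cases)
  case left
  then have "Re (hankel t) = t + pi / 2" by (simp add: hankel_left)
  then show ?thesis using left pi_gt_zero by linarith
next
  case mid
  have "cos t \<le> 1" by simp
  moreover have "Re (hankel t) = cos t" using mid by (simp add: hankel_mid)
  ultimately show ?thesis using mid by linarith
next
  case right
  then have "Re (hankel t) = pi / 2 - t" by (simp add: hankel_right)
  then show ?thesis using right pi_gt_zero by linarith
qed

text \<open>
  A single term of the exponential series.
\<close>

lemma power_le_exp:
  fixes x a :: real
  assumes "x \<ge> 0" "a > 0"
  shows "x ^ p \<le> fact p / a ^ p * exp (a * x)"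
proof -
  have "(\<Sum>n\<in>{p}. (a * x) ^ n /\<^sub>R fact n) \<le> (\<Sum>n. (a * x) ^ n /\<^sub>R fact n)"
    using assms by (intro sum_le_suminf summable_exp_generic) auto
  then have "(a * x) ^ p / fact p \<le> exp (a * x)"
    by (simp add: exp_def field_simps)
  then show ?thesis
    using assms by (simp add: field_simps power_mult_distrib)
qed

text \<open>
  On the rays the real part tends to \<open>- \<infinity>\<close> like \<open>- \<bar>t\<bar>\<close>. Giving up an arbitrarily small part of
  this decay absorbs all powers of the modulus, so every rate \<open>a < 1\<close> is available.
\<close>

lemma hankel_weight_bound:
  assumes "a < 1"
  obtains C where "C \<ge> 0" "\<And>t. norm (hankel t) ^ p * exp (Re (hankel t)) \<le> C * exp (- a * \<bar>t\<bar>)"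
proof
  define e where "e = 1 - a"
  have e: "e > 0" using assms by (simp add: e_def)
  let ?C = "fact p / e ^ p * exp (e + pi / 2 + 1)"
  show "?C \<ge> 0" using e by simp
  fix t
  have "norm (hankel t) ^ p \<le> (1 + \<bar>t\<bar>) ^ p"
    by (intro power_mono norm_hankel_le) auto
  also have "\<dots> \<le> fact p / e ^ p * exp (e * (1 + \<bar>t\<bar>))"
    by (intro power_le_exp e) auto
  finally have "norm (hankel t) ^ p * exp (Re (hankel t)) \<le>
      (fact p / e ^ p * exp (e * (1 + \<bar>t\<bar>))) * exp (pi / 2 + 1 - \<bar>t\<bar>)"
    using e by (intro mult_mono) (auto simp: Re_hankel_le)
  also have "\<dots> = ?C * exp (- a * \<bar>t\<bar>)"
    by (simp add: e_def algebra_simps flip: exp_add)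
  finally show "norm (hankel t) ^ p * exp (Re (hankel t)) \<le> ?C * exp (- a * \<bar>t\<bar>)" .
qed

section \<open>Integrals along the Hankel contour\<close>

definition hankel_integrand :: "(complex \<Rightarrow> complex) \<Rightarrow> real \<Rightarrow> complex"
  where "hankel_integrand f t = f (hankel t) * hankel_deriv t"

lemma hankel_integrand_eq: "f (hankel t) * vector_derivative hankel (at t) = hankel_integrand f t"
  using vector_derivative_at[OF hankel_has_vector_derivative] by (simp add: hankel_integrand_def)

lemma hankel_integrable_iff: "hankel_integrable f \<longleftrightarrow> integrable lborel (hankel_integrand f)"
  by (simp add: hankel_integrable_def hankel_integrand_eq)

lemma hankel_integral_eq: "hankel_integral f = (\<integral>t. hankel_integrand f t \<partial>lborel)"
  by (simp add: hankel_integral_def hankel_integrand_eq)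

lemma continuous_on_hankel_integrand:
  assumes "continuous_on (- \<real>\<^sub>\<le>\<^sub>0) f"
  shows "continuous_on A (hankel_integrand f)"
  unfolding hankel_integrand_def
  by (intro continuous_intros continuous_on_compose2[OF assms]) (auto simp: hankel_not_nonpos_Real)

lemma integrable_exp_abs:
  assumes "a > 0"
  shows "integrable lborel (\<lambda>t :: real. exp (- a * \<bar>t\<bar>))"
proof -
  define g where "g = (\<lambda>t :: real. indicator {0..} t *\<^sub>R exp (- a * t))"
  have "(\<lambda>t. exp (- a * t)) absolutely_integrable_on {0..}"
    using assms by (intro nonnegative_absolutely_integrable_1 integrable_on_exp_minus_to_infinity) auto
  then have "integrable lebesgue g"
    by (simp add: set_integrable_def g_def)
  then have g: "integrable lborel g"
    by (subst (asm) integrable_completion) (auto simp: g_def)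
  then have "integrable lborel (\<lambda>t. g t + g (0 + (-1) * t))"
    by (intro Bochner_Integration.integrable_add lborel_integrable_real_affine) auto
  then show ?thesis
    by (rule Bochner_Integration.integrable_bound) (auto simp: g_def indicator_def)
qed

lemma hankel_integrableI:
  assumes "continuous_on (- \<real>\<^sub>\<le>\<^sub>0) f" "a > 0" "\<And>t. norm (f (hankel t)) \<le> C * exp (- a * \<bar>t\<bar>)"
  shows "hankel_integrable f"
  unfolding hankel_integrable_iff
proof (rule Bochner_Integration.integrable_bound)
  show "integrable lborel (\<lambda>t. C * exp (- a * \<bar>t\<bar>))"
    using integrable_exp_abs[OF assms(2)] by simp
  show "hankel_integrand f \<in> borel_measurable lborel"
    using continuous_on_hankel_integrand[OF assms(1)] by (simp add: borel_measurable_continuous_onI)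
  show "AE t in lborel. norm (hankel_integrand f t) \<le> norm (C * exp (- a * \<bar>t\<bar>))"
    using assms(3) by (auto simp: hankel_integrand_def norm_mult intro!: AE_I2 order_trans[OF _ abs_ge_self])
qed

text \<open>
  The omitted parts of the contour have parameters with \<open>\<bar>t\<bar> > r\<close>. There
  \<open>exp (- a * \<bar>t\<bar>) \<le> exp (- b * r) * exp (- (a - b) * \<bar>t\<bar>)\<close>, and the second factor is integrable
  over the whole line, so no tail integral has to be computed.
\<close>

lemma hankel_integral_tail:
  assumes f: "continuous_on (- \<real>\<^sub>\<le>\<^sub>0) f" and "0 \<le> b" "b < a"
    and bound: "\<And>t. norm (f (hankel t)) \<le> C * exp (- a * \<bar>t\<bar>)"
  obtains K where "K \<ge> 0"
    "\<And>r. r \<ge> 0 \<Longrightarrow> norm (integral {-r..r} (hankel_integrand f) - hankel_integral f) \<le> K * exp (- b * r)"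
proof
  define d where "d = a - b"
  have d: "d > 0" using assms by (simp add: d_def)
  define K where "K = C * (\<integral>t. exp (- d * \<bar>t\<bar>) \<partial>lborel)"
  have "0 \<le> C * exp (- a * \<bar>0\<bar>)"
    using bound[of 0] norm_ge_zero order_trans by blast
  then have C: "C \<ge> 0" by simp
  then show "K \<ge> 0" unfolding K_def by (intro mult_nonneg_nonneg integral_nonneg_AE) auto
  fix r :: real assume r: "r \<ge> 0"
  have int: "integrable lborel (hankel_integrand f)"
    using hankel_integrableI[OF f _ bound] assms by (simp add: hankel_integrable_iff)
  have ints: "set_integrable lborel {-r..r} (hankel_integrand f)"
    using int by (intro integrable_mult_indicator[OF _ int, unfolded set_integrable_def [symmetric]]) auto
  have "integral {-r..r} (hankel_integrand f) - hankel_integral f =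
      (\<integral>t. indicator {-r..r} t *\<^sub>R hankel_integrand f t - hankel_integrand f t \<partial>lborel)"
    using set_borel_integral_eq_integral(2)[OF ints] ints int
    by (simp add: hankel_integral_eq set_lebesgue_integral_def set_integrable_def)
  also have "norm \<dots> \<le> (\<integral>t. C * exp (- b * r) * exp (- d * \<bar>t\<bar>) \<partial>lborel)"
  proof (rule Bochner_Integration.integral_norm_bound_integral)
    show "integrable lborel (\<lambda>t. indicator {-r..r} t *\<^sub>R hankel_integrand f t - hankel_integrand f t)"
      using ints int by (auto simp: set_integrable_def)
    show "integrable lborel (\<lambda>t. C * exp (- b * r) * exp (- d * \<bar>t\<bar>))"
      using integrable_exp_abs[OF d] by simp
    fix t
    show "norm (indicator {-r..r} t *\<^sub>R hankel_integrand f t - hankel_integrand f t) \<le> C * exp (- b * r) * exp (- d * \<bar>t\<bar>)"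
    proof (cases "t \<in> {-r..r}")
      case True
      then show ?thesis using C by simp
    next
      case False
      then have "\<bar>t\<bar> \<ge> r" by auto
      have "norm (hankel_integrand f t) \<le> C * exp (- a * \<bar>t\<bar>)"
        using bound[of t] by (simp add: hankel_integrand_def norm_mult)
      also have "\<dots> \<le> C * exp (- b * r - d * \<bar>t\<bar>)"
      proof (intro mult_left_mono C)
        have "b * r \<le> b * \<bar>t\<bar>" using \<open>\<bar>t\<bar> \<ge> r\<close> \<open>b \<ge> 0\<close> by (rule mult_left_mono)
        then show "exp (- a * \<bar>t\<bar>) \<le> exp (- b * r - d * \<bar>t\<bar>)"
          by (simp add: d_def algebra_simps)
      qed
      finally show ?thesis using False by (simp add: exp_diff exp_minus field_simps)
    qed
  qed
  also have "\<dots> = K * exp (- b * r)"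
    by (simp add: K_def)
  finally show "norm (integral {-r..r} (hankel_integrand f) - hankel_integral f) \<le> K * exp (- b * r)" .
qed

text \<open>
  A segment traversed in the direction \<open>d\<close> for the time \<open>b - a\<close>. With \<open>d = 1\<close> and \<open>d = - 1\<close> these
  are the two rays in the parametrisation of \<open>hankel\<close>.
\<close>

lemma has_contour_integral_linepath_arclength_iff:
  assumes "a < b" "q = p + of_real (b - a) * d"
  shows "(f has_contour_integral I) (linepath p q) \<longleftrightarrow>
    ((\<lambda>t. f (p + of_real (t - a) * d) * d) has_integral I) {a..b}"
proof -
  let ?g = "\<lambda>t. f (p + of_real (t - a) * d) * d"
  have "(?g has_integral I) (cbox a b) \<longleftrightarrow>
      ((\<lambda>x. ?g ((b - a) *\<^sub>R x + a)) has_integral (I /\<^sub>R (b - a))) {0..1}"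
    using has_integral_affinity_iff[of "b - a" ?g a I a b] assms(1) by simp
  also have "\<dots> \<longleftrightarrow> ((\<lambda>x. (b - a) *\<^sub>R ?g ((b - a) *\<^sub>R x + a)) has_integral I) {0..1}"
    using has_integral_cmul_iff[of "b - a" "\<lambda>x. ?g ((b - a) *\<^sub>R x + a)" "I /\<^sub>R (b - a)" "{0..1}"] assms(1) by simp
  also have "(\<lambda>x. (b - a) *\<^sub>R ?g ((b - a) *\<^sub>R x + a)) = (\<lambda>x. f (linepath p q x) * (q - p))"
    by (simp add: fun_eq_iff assms(2) linepath_def scaleR_conv_of_real algebra_simps)
  also have "(\<dots> has_integral I) {0..1} \<longleftrightarrow> (f has_contour_integral I) (linepath p q)"
    by (simp add: has_contour_integral_linepath)
  finally show ?thesis by simp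
qed

lemma has_contour_integral_hankel_pieces:
  fixes R :: real
  assumes f: "continuous_on (- \<real>\<^sub>\<le>\<^sub>0) f"
  shows "R > 0 \<Longrightarrow> (f has_contour_integral integral {- (pi / 2 + R)..- pi / 2} (hankel_integrand f))
      (linepath (- of_real R - \<i>) (- \<i>))"
    and "- pi / 2 \<le> a \<Longrightarrow> a < b \<Longrightarrow> b \<le> pi / 2 \<Longrightarrow>
      (f has_contour_integral integral {a..b} (hankel_integrand f)) (part_circlepath 0 1 a b)"
    and "R > 0 \<Longrightarrow> (f has_contour_integral integral {pi / 2..pi / 2 + R} (hankel_integrand f))
      (linepath \<i> (- of_real R + \<i>))"
proof -
  have int: "(hankel_integrand f has_integral integral {a..b} (hankel_integrand f)) {a..b}" for a b
    by (intro integrable_integral integrable_continuous_interval continuous_on_hankel_integrand f)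
  show "(f has_contour_integral integral {- (pi / 2 + R)..- pi / 2} (hankel_integrand f))
      (linepath (- of_real R - \<i>) (- \<i>))" if "R > 0"
    using that
    by (subst has_contour_integral_linepath_arclength_iff[where a = "- (pi / 2 + R)" and b = "- pi / 2" and d = 1],
        simp_all, intro has_integral_eq[OF _ int])
       (auto simp: hankel_integrand_def hankel_left hankel_deriv_left algebra_simps)
  show "(f has_contour_integral integral {a..b} (hankel_integrand f)) (part_circlepath 0 1 a b)"
    if "- pi / 2 \<le> a" "a < b" "b \<le> pi / 2"
    using that
    by (subst has_contour_integral_part_circlepath_iff, simp, intro has_integral_eq[OF _ int])
       (auto simp: hankel_integrand_def hankel_mid hankel_deriv_mid algebra_simps)
  show "(f has_contour_integral integral {pi / 2..pi / 2 + R} (hankel_integrand f))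
      (linepath \<i> (- of_real R + \<i>))" if "R > 0"
    using that
    by (subst has_contour_integral_linepath_arclength_iff[where a = "pi / 2" and b = "pi / 2 + R" and d = "-1"],
        simp_all, intro has_integral_eq[OF _ int])
       (auto simp: hankel_integrand_def hankel_right hankel_deriv_right algebra_simps)
qed

text \<open>
  Both sides of the symmetric parameter interval are cut at \<open>pi / 2 + R\<close>: the semicircle has
  length \<open>pi\<close>, and a length \<open>R\<close> of each ray remains.
\<close>

lemma contour_integral_hankel_trunc:
  assumes f: "continuous_on (- \<real>\<^sub>\<le>\<^sub>0) f" and R: "R > 0"
  shows "contour_integral (hankel_trunc R) f = integral {- (pi / 2 + R)..pi / 2 + R} (hankel_integrand f)"
proof -
  let ?I = "\<lambda>a b. integral {a..b} (hankel_integrand f)"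
  have int: "hankel_integrand f integrable_on {a..b}" for a b
    by (intro integrable_continuous_interval continuous_on_hankel_integrand f)
  have "(f has_contour_integral (?I (- (pi / 2 + R)) (- pi / 2) + (?I (- pi / 2) (pi / 2) + ?I (pi / 2) (pi / 2 + R))))
      (hankel_trunc R)"
    unfolding hankel_trunc_def using R
    by (intro has_contour_integral_join has_contour_integral_hankel_pieces f valid_path_join) (auto simp flip: cis_conv_exp)
  moreover have "?I (- pi / 2) (pi / 2) + ?I (pi / 2) (pi / 2 + R) = ?I (- pi / 2) (pi / 2 + R)"
    using R by (intro Henstock_Kurzweil_Integration.integral_combine int) auto
  moreover have "?I (- (pi / 2 + R)) (- pi / 2) + ?I (- pi / 2) (pi / 2 + R) = ?I (- (pi / 2 + R)) (pi / 2 + R)"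
    using R by (intro Henstock_Kurzweil_Integration.integral_combine int) auto
  ultimately show ?thesis
    by (simp add: contour_integral_unique)
qed

section \<open>Hankel's formula\<close>

lemma norm_powr_le:
  assumes "w \<noteq> 0"
  shows "norm (w powr z) \<le> exp (Re z * ln (norm w) + pi * \<bar>Im z\<bar>)"
proof -
  have "\<bar>Im z * Im (Ln w)\<bar> \<le> \<bar>Im z\<bar> * pi"
    unfolding abs_mult using Im_Ln_le_pi[OF assms] mpi_less_Im_Ln[OF assms]
    by (intro mult_left_mono) auto
  then have "Re (z * Ln w) \<le> Re z * ln (norm w) + pi * \<bar>Im z\<bar>"
    using assms by (simp add: mult_ac)
  then show ?thesis
    using assms by (simp add: powr_def)
qed

text \<open>
  The right-hand side has its branch cut on the negative imaginary axis. It is therefore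
  continuous on the closed upper half-plane away from 0 and holomorphic inside, whereas the
  principal branch jumps across the negative real axis.
\<close>

lemma powr_eq_rotated_branch:
  assumes "Im w \<ge> 0" "w \<noteq> 0"
  shows "w powr z = (- \<i> * w) powr z * exp (\<i> * of_real pi / 2 * z)"
proof -
  have "Ln (\<i> * (- \<i> * w)) = Ln (- \<i> * w) + \<i> * of_real pi / 2"
    using assms by (subst Ln_times_ii) auto
  also have "\<i> * (- \<i> * w) = w" by simp
  finally show ?thesis
    using assms by (simp add: powr_def algebra_simps flip: exp_add)
qed

lemma minus_of_real_powr:
  assumes "t > 0"
  shows "(- complex_of_real t) powr z = exp (\<i> * of_real pi * z) * of_real t powr z"
proof -
  have 1: "(- complex_of_real t) powr z = (\<i> * of_real t) powr z * exp (\<i> * of_real pi / 2 * z)"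
    using assms by (subst powr_eq_rotated_branch) auto
  have 2: "(\<i> * of_real t) powr z = of_real t powr z * exp (\<i> * of_real pi / 2 * z)"
    using assms by (subst powr_eq_rotated_branch) auto
  have "exp (\<i> * of_real pi / 2 * z) * exp (\<i> * of_real pi / 2 * z) = exp (\<i> * of_real pi * z)"
    by (simp add: mult_ac flip: exp_add)
  then show ?thesis
    unfolding 1 2 by (simp add: mult_ac)
qed

text \<open>
  The definition of the gauge integral over an unbounded set compares integrals over boxes with
  the limit; the boxes \<open>[- R, R]\<close> suffice.
\<close>

lemma has_integral_atLeast_imp_tendsto:
  fixes f :: "real \<Rightarrow> 'a :: banach"
  assumes "(f has_integral I) {0..}"
  shows "((\<lambda>R. integral {0..R} f) \<longlongrightarrow> I) at_top"
proof (rule tendstoI)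
  fix e :: real assume "e > 0"
  from iffD1[OF has_integral' assms, rule_format, OF \<open>e > 0\<close>] obtain B where B: "B > 0" and close: "\<forall>a b. ball 0 B \<subseteq> cbox a b \<longrightarrow>
      (\<exists>z. ((\<lambda>x. if x \<in> {0..} then f x else 0) has_integral z) (cbox a b) \<and> norm (z - I) < e)"
    by blast
  have "dist (integral {0..R} f) I < e" if "R \<ge> B" for R
  proof -
    have "ball 0 B \<subseteq> cbox (- R) R" using that by (auto simp: dist_real_def)
    from close [rule_format, OF this] obtain z where
      z: "((\<lambda>x. if x \<in> {0..} then f x else 0) has_integral z) (cbox (- R) R)" "norm (z - I) < e" by blast
    have "(f has_integral z) ({0..} \<inter> cbox (- R) R)"
      using z(1) by (simp only: has_integral_restrict_Int)
    also have "{0..} \<inter> cbox (- R) R = {0..R}" using that B by auto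
    finally show ?thesis using z(2) by (simp add: integral_unique dist_norm)
  qed
  then show "\<forall>\<^sub>F R in at_top. dist (integral {0..R} f) I < e"
    by (rule eventually_mono[OF eventually_ge_at_top])
qed

definition powr_exp :: "complex \<Rightarrow> complex \<Rightarrow> complex"
  where "powr_exp z w = w powr z * exp w"

lemma continuous_on_powr_exp: "continuous_on (- \<real>\<^sub>\<le>\<^sub>0) (powr_exp z)"
  unfolding powr_exp_def by (intro continuous_intros) (auto simp: complex_nonpos_Reals_iff)

text \<open>
  In the closed upper half-plane, the part of the contour from \<open>1\<close> via \<open>\<i>\<close> to \<open>- R + \<i>\<close> is closed
  up by the vertical segment down to \<open>- R\<close> and the real segments to \<open>0\<close> and on to \<open>1\<close>. The real
  segments account for the two explicit integrals, and the right-hand side bounds the vertical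
  segment. The assumption \<open>Re z > 0\<close> makes the integrand continuous at the origin, where the
  closed path touches the branch point. Cauchy's theorem for convex sets asks for holomorphy only
  in the interior, so the path may run along the boundary of the half-plane.
\<close>

lemma upper_half_hankel_Cauchy:
  assumes z: "Re z > 0" and R: "R > 0"
  shows "norm (integral {0..pi / 2 + R} (hankel_integrand (powr_exp z)) +
      (exp (\<i> * of_real pi * z) * integral {0..R} (\<lambda>t. of_real t powr z / of_real (exp t)) +
       integral {0..1} (\<lambda>t. of_real t powr z * of_real (exp t))))
    \<le> exp (Re z * ln (R + 1) + pi * \<bar>Im z\<bar> - R)"
proof -
  define g where "g = (\<lambda>w. (- \<i> * w) powr z * exp (\<i> * of_real pi / 2 * z) * exp w)"
  have g_eq: "powr_exp z w = g w" if "Im w \<ge> 0" "w \<noteq> 0" for w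
    using powr_eq_rotated_branch[OF that] by (simp add: g_def powr_exp_def)
  define S where "S = {w. Im w \<ge> 0}"
  have S: "convex S" unfolding S_def by (rule convex_halfspace_Im_ge)
  have cont: "continuous_on S g"
    unfolding g_def S_def using z by (intro continuous_intros) auto
  have diff: "g field_differentiable at w" if "w \<in> interior S - {}" for w
  proof -
    have "Im w > 0"
      using interior_halfspace_ge[of \<i> 0] that by (simp add: S_def inner_complex_def)
    then have "- \<i> * w \<notin> \<real>\<^sub>\<le>\<^sub>0" by (simp add: complex_nonpos_Reals_iff)
    then have "(g has_field_derivative
        (- \<i> * (z * (- \<i> * w) powr (z - 1))) * exp (\<i> * of_real pi / 2 * z) * exp w + g w) (at w)"
      unfolding g_def by (auto intro!: derivative_eq_intros simp: algebra_simps)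
    then show ?thesis using field_differentiable_def by blast
  qed
  define p where "p = - complex_of_real R"
  define \<gamma> where "\<gamma> = part_circlepath 0 1 0 (pi / 2) +++ linepath \<i> (p + \<i>) +++
    linepath (p + \<i>) p +++ linepath p 0 +++ linepath 0 1"
  have ends: "pathfinish (part_circlepath 0 1 0 (pi / 2)) = \<i>" "pathstart (part_circlepath 0 1 0 (pi / 2)) = 1"
    by simp_all
  have segS: "closed_segment a b \<subseteq> S" if "a \<in> S" "b \<in> S" for a b
    using S that by (simp add: closed_segment_subset)
  have circS: "path_image (part_circlepath 0 1 0 (pi / 2)) \<subseteq> S"
    by (auto simp: path_image_part_circlepath S_def sin_ge_zero simp flip: cis_conv_exp)
  have inS: "\<i> \<in> S" "p + \<i> \<in> S" "p \<in> S" "0 \<in> S" "1 \<in> S"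
    by (simp_all add: S_def p_def)
  have "(g has_contour_integral 0) \<gamma>"
  proof (rule Cauchy_theorem_convex[OF cont S finite.emptyI diff])
    show "path_image \<gamma> \<subseteq> S"
      unfolding \<gamma>_def path_image_linepath
      by (intro subset_path_image_join circS) (simp_all add: segS inS)
    show "valid_path \<gamma>"
      unfolding \<gamma>_def by (intro valid_path_join) (simp_all add: ends)
    show "pathfinish \<gamma> = pathstart \<gamma>"
      by (simp add: \<gamma>_def ends)
  qed
  have lineint: "(g has_contour_integral contour_integral (linepath a b) g) (linepath a b)"
    if "a \<in> S" "b \<in> S" for a b
    by (intro has_contour_integral_integral contour_integrable_continuous_linepath
          continuous_on_subset[OF cont] segS that)
  let ?I = "\<lambda>a b. integral {a..b} (hankel_integrand (powr_exp z))"
  have circ: "(g has_contour_integral ?I 0 (pi / 2)) (part_circlepath 0 1 0 (pi / 2))"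
  proof (rule has_contour_integral_eq)
    show "(powr_exp z has_contour_integral ?I 0 (pi / 2)) (part_circlepath 0 1 0 (pi / 2))"
      by (rule has_contour_integral_hankel_pieces(2)[OF continuous_on_powr_exp]) auto
    fix w assume "w \<in> path_image (part_circlepath 0 1 0 (pi / 2))"
    then show "powr_exp z w = g w"
      using circS by (intro g_eq) (auto simp: S_def path_image_part_circlepath)
  qed
  have ray: "(g has_contour_integral ?I (pi / 2) (pi / 2 + R)) (linepath \<i> (p + \<i>))"
  proof (rule has_contour_integral_eq)
    show "(powr_exp z has_contour_integral ?I (pi / 2) (pi / 2 + R)) (linepath \<i> (p + \<i>))"
      unfolding p_def by (rule has_contour_integral_hankel_pieces(3)[OF continuous_on_powr_exp R])
    fix w assume "w \<in> path_image (linepath \<i> (p + \<i>))"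
    then have "Im w = 1" by (simp add: p_def closed_segment_same_Im)
    then show "powr_exp z w = g w" by (intro g_eq) auto
  qed
  have "(g has_contour_integral (?I 0 (pi / 2) + (?I (pi / 2) (pi / 2 + R) +
      (contour_integral (linepath (p + \<i>) p) g + (contour_integral (linepath p 0) g + contour_integral (linepath 0 1) g))))) \<gamma>"
    unfolding \<gamma>_def using inS
    by (intro has_contour_integral_join circ ray lineint valid_path_join) (simp_all add: ends)
  with \<open>(g has_contour_integral 0) \<gamma>\<close> have sum0:
    "?I 0 (pi / 2) + (?I (pi / 2) (pi / 2 + R) +
      (contour_integral (linepath (p + \<i>) p) g + (contour_integral (linepath p 0) g + contour_integral (linepath 0 1) g))) = 0"
    by (simp add: has_contour_integral_unique)
  have comb: "?I 0 (pi / 2) + ?I (pi / 2) (pi / 2 + R) = ?I 0 (pi / 2 + R)"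
    using R by (intro Henstock_Kurzweil_Integration.integral_combine integrable_continuous_interval
          continuous_on_hankel_integrand continuous_on_powr_exp) auto
  have seg01: "contour_integral (linepath 0 1) g = integral {0..1} (\<lambda>t. of_real t powr z * of_real (exp t))"
  proof -
    have "contour_integral (linepath 0 1) g = integral {0..1} (\<lambda>t. g (of_real t))"
      by (subst contour_integral_linepath_Reals_eq) auto
    also have "\<dots> = integral {0..1} (\<lambda>t. of_real t powr z * of_real (exp t))"
    proof (rule integral_cong)
      fix t :: real assume "t \<in> {0..1}"
      then show "g (of_real t) = of_real t powr z * of_real (exp t)"
        using g_eq[of "of_real t"] by (cases "t = 0") (auto simp: powr_exp_def exp_of_real g_def)
    qed
    finally show ?thesis .
  qed
  have segp0: "contour_integral (linepath p 0) g =
      exp (\<i> * of_real pi * z) * integral {0..R} (\<lambda>t. of_real t powr z / of_real (exp t))"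
  proof -
    have "contour_integral (linepath p 0) g = integral {- R..0} (\<lambda>t. g (of_real t))"
      using R by (subst contour_integral_linepath_Reals_eq) (auto simp: p_def)
    also have "\<dots> = integral {0..R} (\<lambda>t. g (of_real (- t)))"
      using Henstock_Kurzweil_Integration.integral_reflect_real[of R 0 "\<lambda>t. g (of_real (- t))"] by simp
    also have "\<dots> = integral {0..R} (\<lambda>t. exp (\<i> * of_real pi * z) * (of_real t powr z / of_real (exp t)))"
    proof (rule integral_cong)
      fix t :: real assume t: "t \<in> {0..R}"
      show "g (of_real (- t)) = exp (\<i> * of_real pi * z) * (of_real t powr z / of_real (exp t))"
      proof (cases "t = 0")
        case False
        then have "g (of_real (- t)) = (- of_real t) powr z * exp (- of_real t)"
          using t g_eq[of "of_real (- t)"] by (simp add: powr_exp_def)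
        also have "\<dots> = exp (\<i> * of_real pi * z) * (of_real t powr z / of_real (exp t))"
          using t False by (subst minus_of_real_powr) (auto simp: exp_minus exp_of_real field_simps)
        finally show ?thesis .
      qed (simp add: g_def)
    qed
    finally show ?thesis
      by (simp only: Henstock_Kurzweil_Integration.integral_mult_right)
  qed
  have vert: "norm (contour_integral (linepath (p + \<i>) p) g) \<le> exp (Re z * ln (R + 1) + pi * \<bar>Im z\<bar> - R) * norm (p - (p + \<i>))"
  proof (rule has_contour_integral_bound_linepath[OF lineint])
    fix w assume "w \<in> closed_segment (p + \<i>) p"
    then have w: "Re w = - R" "0 \<le> Im w" "Im w \<le> 1"
      by (simp_all add: closed_segment_same_Re closed_segment_eq_real_ivl p_def)
    then have "w \<noteq> 0" using R by auto
    have "norm w \<le> R + 1"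
      using cmod_le[of w] w R by simp
    then have "ln (norm w) \<le> ln (R + 1)" using \<open>w \<noteq> 0\<close> R by (subst ln_le_cancel_iff) auto
    then have "Re z * ln (norm w) \<le> Re z * ln (R + 1)" using z by simp
    then have "norm (w powr z) \<le> exp (Re z * ln (R + 1) + pi * \<bar>Im z\<bar>)"
      by (intro order_trans[OF norm_powr_le[OF \<open>w \<noteq> 0\<close>]]) simp
    then have "norm (w powr z) * exp (- R) \<le> exp (Re z * ln (R + 1) + pi * \<bar>Im z\<bar>) * exp (- R)"
      by (rule mult_right_mono) simp
    also have "norm (w powr z) * exp (- R) = norm (g w)"
      using w \<open>w \<noteq> 0\<close> by (simp add: powr_exp_def norm_mult flip: g_eq)
    finally show "norm (g w) \<le> exp (Re z * ln (R + 1) + pi * \<bar>Im z\<bar> - R)"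
      by (simp flip: exp_add)
  qed (use inS in auto)
  have "?I 0 (pi / 2 + R) + (contour_integral (linepath p 0) g + contour_integral (linepath 0 1) g) =
      - contour_integral (linepath (p + \<i>) p) g"
    using sum0 unfolding comb [symmetric] by (simp only: eq_neg_iff_add_eq_0) (simp only: add_ac)
  then have "norm (?I 0 (pi / 2 + R) + (contour_integral (linepath p 0) g + contour_integral (linepath 0 1) g)) \<le>
      exp (Re z * ln (R + 1) + pi * \<bar>Im z\<bar> - R)"
    using vert by (simp only:) simp
  then show ?thesis
    unfolding seg01 segp0 .
qed

lemma tendsto_exp_log_minus_linear:
  "((\<lambda>R :: real. exp (a * ln (R + 1) + c - R)) \<longlongrightarrow> 0) at_top"
  by real_asymp

lemma upper_half_hankel_tendsto:
  assumes z: "Re z > 0"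
  shows "((\<lambda>R. integral {0..pi / 2 + R} (hankel_integrand (powr_exp z))) \<longlongrightarrow>
    - (exp (\<i> * of_real pi * z) * Gamma (z + 1) + integral {0..1} (\<lambda>t. of_real t powr z * of_real (exp t)))) at_top"
proof -
  define A where "A = integral {0..1} (\<lambda>t. of_real t powr z * complex_of_real (exp t))"
  define U where "U = (\<lambda>R. integral {0..pi / 2 + R} (hankel_integrand (powr_exp z)))"
  define G where "G = (\<lambda>R. exp (\<i> * of_real pi * z) * integral {0..R} (\<lambda>t. of_real t powr z / of_real (exp t)) + A)"
  have "((\<lambda>R. exp (Re z * ln (R + 1) + pi * \<bar>Im z\<bar> - R)) \<longlongrightarrow> 0) at_top"
    by (rule tendsto_exp_log_minus_linear)
  moreover have "\<forall>\<^sub>F R in at_top. norm (U R + G R) \<le> exp (Re z * ln (R + 1) + pi * \<bar>Im z\<bar> - R)"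
    using eventually_gt_at_top[of 0]
    by eventually_elim (unfold U_def G_def A_def, rule upper_half_hankel_Cauchy[OF z])
  ultimately have "((\<lambda>R. U R + G R) \<longlongrightarrow> 0) at_top"
    by (rule Lim_null_comparison[rotated])
  moreover have "(G \<longlongrightarrow> exp (\<i> * of_real pi * z) * Gamma (z + 1) + A) at_top"
    unfolding G_def using Gamma_integral_complex[of "z + 1"] z
    by (intro tendsto_intros has_integral_atLeast_imp_tendsto) auto
  ultimately have "((\<lambda>R. (U R + G R) - G R) \<longlongrightarrow> 0 - (exp (\<i> * of_real pi * z) * Gamma (z + 1) + A)) at_top"
    by (rule tendsto_diff)
  then have "(U \<longlongrightarrow> - (exp (\<i> * of_real pi * z) * Gamma (z + 1) + A)) at_top"
    by (simp only: add_diff_cancel_right' diff_0)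
  then show ?thesis
    unfolding U_def A_def .
qed

text \<open>
  The lower half of the contour is the complex conjugate of the upper half, traversed backwards.
\<close>

lemma hankel_integrand_powr_exp_minus:
  "hankel_integrand (powr_exp z) (- t) = - cnj (hankel_integrand (powr_exp (cnj z)) t)"
proof -
  have "cnj (hankel t powr cnj z) = cnj (hankel t) powr z"
    using hankel_not_nonpos_Real[of t]
    by (subst cnj_powr) (auto simp: complex_nonpos_Reals_iff)
  then show ?thesis
    by (simp add: hankel_integrand_def powr_exp_def hankel_minus hankel_deriv_minus exp_cnj)
qed

lemma sin_eq_exp_diff: "exp (\<i> * of_real pi * z) - exp (- (\<i> * of_real pi * z)) = 2 * \<i> * sin (of_real pi * z)"
  by (simp add: sin_exp_eq algebra_simps)

text \<open>
  In the difference of the two halves the integrals over \<open>[0, 1]\<close> cancel, and the remaining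
  integrals over \<open>[0, \<infinity>)\<close> combine to \<open>- 2 \<i> sin (pi z) \<Gamma> (z + 1)\<close>, which the reflection formula
  turns into the reciprocal Gamma function.
\<close>

lemma hankel_symmetric_tendsto:
  assumes z: "Re z > 0"
  shows "((\<lambda>R. integral {- (pi / 2 + R)..pi / 2 + R} (hankel_integrand (powr_exp z))) \<longlongrightarrow>
    2 * of_real pi * \<i> * rGamma (- z)) at_top"
proof -
  let ?F = "\<lambda>z. hankel_integrand (powr_exp z)"
  define A where "A = (\<lambda>z. integral {0..1} (\<lambda>t. of_real t powr z * complex_of_real (exp t)))"
  have cont: "continuous_on S (?F z)" for S z
    by (intro continuous_on_hankel_integrand continuous_on_powr_exp)
  have "cnj (A (cnj z)) = A z"
    unfolding A_def integral_cnj by (intro integral_cong) (auto simp: cnj_powr)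
  have "((\<lambda>R. integral {0..pi / 2 + R} (?F z) - cnj (integral {0..pi / 2 + R} (?F (cnj z)))) \<longlongrightarrow>
      - (exp (\<i> * of_real pi * z) * Gamma (z + 1) + A z) -
        cnj (- (exp (\<i> * of_real pi * cnj z) * Gamma (cnj z + 1) + A (cnj z)))) at_top"
    unfolding A_def using z by (intro tendsto_diff tendsto_cnj upper_half_hankel_tendsto) auto
  also have "- (exp (\<i> * of_real pi * z) * Gamma (z + 1) + A z) -
        cnj (- (exp (\<i> * of_real pi * cnj z) * Gamma (cnj z + 1) + A (cnj z))) =
      - (exp (\<i> * of_real pi * z) - exp (- (\<i> * of_real pi * z))) * Gamma (z + 1)"
    using \<open>cnj (A (cnj z)) = A z\<close> by (simp add: exp_cnj cnj_Gamma algebra_simps)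
  also have "\<dots> = - (2 * \<i> * sin (of_real pi * z)) * Gamma (z + 1)"
    by (simp only: sin_eq_exp_diff)
  also have "\<dots> = 2 * of_real pi * \<i> * rGamma (- z)"
  proof -
    have "z + 1 \<notin> \<int>\<^sub>\<le>\<^sub>0" using z by (auto elim!: nonpos_Ints_cases simp: complex_eq_iff)
    then have "Gamma (z + 1) \<noteq> 0" by (simp add: Gamma_eq_zero_iff)
    then have "rGamma (- z) = rGamma (- z) * rGamma (1 - (- z)) * Gamma (z + 1)"
      by (simp add: rGamma_inverse_Gamma[of "1 + z"] add.commute)
    also have "\<dots> = - sin (of_real pi * z) / of_real pi * Gamma (z + 1)"
      by (simp only: rGamma_reflection_complex) simp
    finally show ?thesis by simp
  qed
  finally have lim: "((\<lambda>R. integral {0..pi / 2 + R} (?F z) - cnj (integral {0..pi / 2 + R} (?F (cnj z)))) \<longlongrightarrow>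
    2 * of_real pi * \<i> * rGamma (- z)) at_top" .
  have halves: "integral {- r..r} (?F z) = integral {0..r} (?F z) - cnj (integral {0..r} (?F (cnj z)))" if "r \<ge> 0" for r
  proof -
    have "integral {- r..0} (?F z) = integral {0..r} (\<lambda>t. ?F z (- t))"
      using Henstock_Kurzweil_Integration.integral_reflect_real[of r 0 "\<lambda>t. ?F z (- t)"] by simp
    also have "\<dots> = - cnj (integral {0..r} (?F (cnj z)))"
      by (simp add: hankel_integrand_powr_exp_minus integral_cnj)
    finally show ?thesis
      using Henstock_Kurzweil_Integration.integral_combine[of "- r" 0 r "?F z"] that
        integrable_continuous_interval[OF cont] by simp
  qed
  have "\<forall>\<^sub>F R in at_top. integral {0..pi / 2 + R} (?F z) - cnj (integral {0..pi / 2 + R} (?F (cnj z))) =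
      integral {- (pi / 2 + R)..pi / 2 + R} (?F z)"
    using eventually_ge_at_top[of 0] by eventually_elim (rule halves [symmetric], simp)
  with lim show ?thesis by (rule Lim_transform_eventually)
qed

lemma norm_powr_exp_hankel_le:
  "norm (powr_exp z (hankel t)) \<le> exp (pi * \<bar>Im z\<bar>) * (norm (hankel t) ^ nat \<lceil>Re z\<rceil> * exp (Re (hankel t)))"
proof -
  have ge: "norm (hankel t) \<ge> 1" by (rule norm_hankel_ge_1)
  then have nz: "hankel t \<noteq> 0" by auto
  have "Re z \<le> real (nat \<lceil>Re z\<rceil>)" by linarith
  then have "Re z * ln (norm (hankel t)) \<le> real (nat \<lceil>Re z\<rceil>) * ln (norm (hankel t))"
    using ge by (intro mult_right_mono) auto
  then have "exp (Re z * ln (norm (hankel t)) + pi * \<bar>Im z\<bar>) \<le> exp (real (nat \<lceil>Re z\<rceil>) * ln (norm (hankel t)) + pi * \<bar>Im z\<bar>)"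
    by simp
  also have "\<dots> = exp (pi * \<bar>Im z\<bar>) * norm (hankel t) ^ nat \<lceil>Re z\<rceil>"
    using nz by (simp add: exp_add exp_of_nat_mult)
  finally show ?thesis
    using norm_powr_le[OF nz, of z] by (simp add: powr_exp_def norm_mult mult_right_mono mult_ac)
qed

lemma hankel_integral_powr_exp:
  assumes z: "Re z > 0"
  shows "hankel_integral (powr_exp z) = 2 * of_real pi * \<i> * rGamma (- z)"
proof -
  obtain C where C: "\<And>t. norm (hankel t) ^ nat \<lceil>Re z\<rceil> * exp (Re (hankel t)) \<le> C * exp (- (1/2) * \<bar>t\<bar>)"
    by (rule hankel_weight_bound[of "1/2" "nat \<lceil>Re z\<rceil>"]) auto
  have bound: "norm (powr_exp z (hankel t)) \<le> exp (pi * \<bar>Im z\<bar>) * C * exp (- (1/2) * \<bar>t\<bar>)" for t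
  proof -
    have "exp (pi * \<bar>Im z\<bar>) * (norm (hankel t) ^ nat \<lceil>Re z\<rceil> * exp (Re (hankel t))) \<le>
        exp (pi * \<bar>Im z\<bar>) * (C * exp (- (1/2) * \<bar>t\<bar>))"
      by (intro mult_left_mono C) auto
    from order_trans[OF norm_powr_exp_hankel_le this] show ?thesis
      by (simp only: mult.assoc)
  qed
  obtain K where K: "\<And>r. r \<ge> 0 \<Longrightarrow>
      norm (integral {-r..r} (hankel_integrand (powr_exp z)) - hankel_integral (powr_exp z)) \<le> K * exp (- (1/4) * r)"
    using hankel_integral_tail[OF continuous_on_powr_exp _ _ bound, of "1/4"] by auto
  let ?I = "\<lambda>R. integral {- (pi / 2 + R)..pi / 2 + R} (hankel_integrand (powr_exp z))"
  have "((\<lambda>R. K * exp (- (1/4) * (pi / 2 + R))) \<longlongrightarrow> 0) at_top"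
    by real_asymp
  moreover have "\<forall>\<^sub>F R in at_top. norm (?I R - hankel_integral (powr_exp z)) \<le> K * exp (- (1/4) * (pi / 2 + R))"
    using eventually_ge_at_top[of 0] by eventually_elim (intro K, simp)
  ultimately have "((\<lambda>R. ?I R - hankel_integral (powr_exp z)) \<longlongrightarrow> 0) at_top"
    by (rule Lim_null_comparison[rotated])
  then have "(?I \<longlongrightarrow> hankel_integral (powr_exp z)) at_top"
    by (simp add: LIM_zero_iff)
  with hankel_symmetric_tendsto[OF z] show ?thesis
    using tendsto_unique trivial_limit_at_top_linorder by blast
qed

section \<open>Powers of the logarithm\<close>

definition log_power_exp :: "nat \<Rightarrow> nat \<Rightarrow> complex \<Rightarrow> complex"
  where "log_power_exp n m w = Ln w ^ m * w ^ n * exp w"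

lemma continuous_on_log_power_exp: "continuous_on (- \<real>\<^sub>\<le>\<^sub>0) (log_power_exp n m)"
  unfolding log_power_exp_def by (intro continuous_intros) auto

lemma power_div_fact_le_exp:
  fixes x :: real
  assumes "x \<ge> 0"
  shows "x ^ m / fact m \<le> exp x"
  using power_le_exp[of x 1 m] assms by (simp add: field_simps)

text \<open>
  Because \<open>ln \<bar>w\<bar> \<ge> 0\<close> on the contour, \<open>exp \<bar>Ln w\<bar>\<close> is at most \<open>exp pi\<close> times \<open>\<bar>w\<bar>\<close>. Uniformity in
  \<open>m\<close> is what allows the sum over \<open>m\<close> to be integrated termwise later.
\<close>

lemma norm_Ln_power_hankel_le:
  "norm (Ln (hankel s)) ^ m / fact m \<le> exp pi * norm (hankel s)"
proof -
  have ge: "norm (hankel s) \<ge> 1" by (rule norm_hankel_ge_1)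
  then have nz: "hankel s \<noteq> 0" by auto
  have "norm (Ln (hankel s)) \<le> \<bar>Re (Ln (hankel s))\<bar> + \<bar>Im (Ln (hankel s))\<bar>"
    by (rule cmod_le)
  also have "\<bar>Im (Ln (hankel s))\<bar> \<le> pi"
    using Im_Ln_le_pi[OF nz] mpi_less_Im_Ln[OF nz] by auto
  also have "\<bar>Re (Ln (hankel s))\<bar> = ln (norm (hankel s))"
    using nz ge by simp
  finally have le: "norm (Ln (hankel s)) \<le> ln (norm (hankel s)) + pi" by simp
  have "norm (Ln (hankel s)) ^ m / fact m \<le> exp (norm (Ln (hankel s)))"
    by (rule power_div_fact_le_exp) simp
  also have "\<dots> \<le> exp (ln (norm (hankel s)) + pi)"
    using le by simp
  also have "\<dots> = exp pi * norm (hankel s)"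
    using nz by (simp add: exp_add)
  finally show ?thesis .
qed

lemma norm_log_power_exp_hankel_le:
  "norm (log_power_exp n m (hankel s)) \<le>
    fact m * (exp pi * (norm (hankel s) ^ Suc n * exp (Re (hankel s))))"
proof -
  have "norm (Ln (hankel s)) ^ m / fact m * (norm (hankel s) ^ n * exp (Re (hankel s))) \<le>
      (exp pi * norm (hankel s)) * (norm (hankel s) ^ n * exp (Re (hankel s)))"
    by (intro mult_right_mono norm_Ln_power_hankel_le) auto
  then show ?thesis
    by (simp add: log_power_exp_def norm_mult norm_power field_simps)
qed

lemma log_power_exp_hankel_decay:
  assumes "a < 1"
  obtains C where "C \<ge> 0" "\<And>m s. norm (log_power_exp n m (hankel s)) \<le> fact m * C * exp (- a * \<bar>s\<bar>)"
proof -
  obtain C where C: "C \<ge> 0" "\<And>s. norm (hankel s) ^ Suc n * exp (Re (hankel s)) \<le> C * exp (- a * \<bar>s\<bar>)"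
    by (rule hankel_weight_bound[OF assms, of "Suc n"]) auto
  show ?thesis
  proof
    show "exp pi * C \<ge> 0" using C by simp
    fix m s
    have "fact m * (exp pi * (norm (hankel s) ^ Suc n * exp (Re (hankel s)))) \<le>
        fact m * (exp pi * (C * exp (- a * \<bar>s\<bar>)))"
      by (intro mult_left_mono C) auto
    from order_trans[OF norm_log_power_exp_hankel_le this]
    show "norm (log_power_exp n m (hankel s)) \<le> fact m * (exp pi * C) * exp (- a * \<bar>s\<bar>)"
      by (simp only: mult.assoc)
  qed
qed

lemma hankel_integrable_log_power_exp: "hankel_integrable (log_power_exp n m)"
proof -
  obtain C where "\<And>m s. norm (log_power_exp n m (hankel s)) \<le> fact m * C * exp (- (1/2) * \<bar>s\<bar>)"
    by (rule log_power_exp_hankel_decay[of "1/2" n]) auto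
  then show ?thesis
    by (intro hankel_integrableI[where a = "1/2"] continuous_on_log_power_exp) auto
qed

text \<open>
  Expanding \<open>w powr (n + t) = w ^ n * exp (t * Ln w)\<close> in powers of \<open>t\<close> and integrating termwise.
  By \<open>log_power_exp_hankel_decay\<close>, the absolute value of the \<open>m\<close>-th term has an integral of at
  most a constant times \<open>\<bar>t\<bar> ^ m\<close>, which is summable for \<open>\<bar>t\<bar> < 1\<close>.
\<close>

lemma hankel_integral_log_power_exp_sums:
  fixes t :: complex
  assumes t: "norm t < 1"
  shows "(\<lambda>m. hankel_integral (log_power_exp n m) / fact m * t ^ m) sums
    hankel_integral (powr_exp (of_nat n + t))"
proof -
  define F where "F = (\<lambda>m s. t ^ m / fact m * hankel_integrand (log_power_exp n m) s)"
  obtain C where C: "C \<ge> 0" "\<And>m s. norm (log_power_exp n m (hankel s)) \<le> fact m * C * exp (- (1/2) * \<bar>s\<bar>)"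
    by (rule log_power_exp_hankel_decay[of "1/2" n]) auto
  have int: "integrable lborel (hankel_integrand (log_power_exp n m))" for m
    using hankel_integrable_log_power_exp by (simp add: hankel_integrable_iff)
  have intF: "integrable lborel (F m)" for m
    unfolding F_def using int by simp
  have F_sums: "(\<lambda>m. F m s) sums hankel_integrand (powr_exp (of_nat n + t)) s" for s
  proof -
    have nz: "hankel s \<noteq> 0" using norm_hankel_ge_1[of s] by auto
    have "(\<lambda>m. ((t * Ln (hankel s)) ^ m /\<^sub>R fact m) * (hankel s ^ n * exp (hankel s) * hankel_deriv s)) sums
        (exp (t * Ln (hankel s)) * (hankel s ^ n * exp (hankel s) * hankel_deriv s))"
      by (intro sums_mult2 exp_converges)
    also have "exp (t * Ln (hankel s)) * (hankel s ^ n * exp (hankel s) * hankel_deriv s) =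
        hankel_integrand (powr_exp (of_nat n + t)) s"
      using nz by (simp add: hankel_integrand_def powr_exp_def powr_add) (simp add: powr_def mult_ac)
    also have "(\<lambda>m. ((t * Ln (hankel s)) ^ m /\<^sub>R fact m) * (hankel s ^ n * exp (hankel s) * hankel_deriv s)) =
        (\<lambda>m. F m s)"
      by (simp add: F_def hankel_integrand_def log_power_exp_def power_mult_distrib scaleR_conv_of_real field_simps)
    finally show ?thesis .
  qed
  have bound: "norm (F m s) \<le> norm t ^ m * (C * exp (- (1/2) * \<bar>s\<bar>))" for m s
  proof -
    have "norm (F m s) = norm t ^ m / fact m * norm (log_power_exp n m (hankel s))"
      by (simp add: F_def hankel_integrand_def norm_mult norm_divide norm_power)
    also have "\<dots> \<le> norm t ^ m / fact m * (fact m * C * exp (- (1/2) * \<bar>s\<bar>))"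
      by (intro mult_left_mono C) auto
    finally show ?thesis by (simp add: mult_ac)
  qed
  have summable: "summable (\<lambda>m. norm t ^ m * B)" for B :: real
    using t by (intro summable_mult2 summable_geometric) simp
  have "(\<lambda>m. integral\<^sup>L lborel (F m)) sums (\<integral>s. (\<Sum>m. F m s) \<partial>lborel)"
  proof (rule sums_integral[OF intF])
    show "AE s in lborel. summable (\<lambda>m. norm (F m s))"
      using bound by (intro AE_I2 summable_comparison_test'[OF summable]) auto
    have "(\<integral>s. norm (F m s) \<partial>lborel) \<le> norm t ^ m * (\<integral>s. C * exp (- (1/2) * \<bar>s\<bar>) \<partial>lborel)" for m
    proof -
      have "(\<integral>s. norm (F m s) \<partial>lborel) \<le> (\<integral>s. norm t ^ m * (C * exp (- (1/2) * \<bar>s\<bar>)) \<partial>lborel)"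
        using intF integrable_exp_abs[of "1/2"] bound by (intro integral_mono) auto
      then show ?thesis by simp
    qed
    then show "summable (\<lambda>m. \<integral>s. norm (F m s) \<partial>lborel)"
      by (intro summable_comparison_test'[OF summable]) (auto simp: integral_nonneg_AE)
  qed
  also have "(\<integral>s. (\<Sum>m. F m s) \<partial>lborel) = hankel_integral (powr_exp (of_nat n + t))"
    using F_sums by (simp add: hankel_integral_eq sums_iff)
  also have "(\<lambda>m. integral\<^sup>L lborel (F m)) = (\<lambda>m. hankel_integral (log_power_exp n m) / fact m * t ^ m)"
    by (simp add: F_def hankel_integral_eq mult_ac)
  finally show ?thesis .
qed

text \<open>
  Both sides, divided by \<open>m!\<close>, are Taylor coefficients of \<open>rGamma (- (n + t))\<close> at \<open>t = 0\<close>; thus no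
  differentiation under the integral sign is needed.
\<close>

lemma hankel_integral_log_power_exp:
  assumes n: "n > 0"
  shows "1 / (2 * of_real pi * \<i>) * hankel_integral (log_power_exp n m) = Gamma_coeff n m"
proof -
  define G where "G = Abs_fps (\<lambda>m. 1 / (2 * of_real pi * \<i>) * (hankel_integral (log_power_exp n m) / fact m))"
  have "(\<lambda>t. rGamma (- (of_nat n + t))) has_fps_expansion G"
  proof (rule has_fps_expansionI)
    have "\<forall>\<^sub>F t in nhds 0. t \<in> ball (0 :: complex) 1"
      by (intro eventually_nhds_in_open) auto
    then show "\<forall>\<^sub>F t in nhds 0. (\<lambda>m. fps_nth G m * t ^ m) sums rGamma (- (of_nat n + t))"
    proof eventually_elim
      case (elim t)
      then have t: "norm t < 1" by simp
      then have "Re (of_nat n + t) > 0"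
        using abs_Re_le_cmod[of t] n by simp
      then have "(\<lambda>m. hankel_integral (log_power_exp n m) / fact m * t ^ m) sums
          (2 * of_real pi * \<i> * rGamma (- (of_nat n + t)))"
        using hankel_integral_log_power_exp_sums[OF t, of n] by (simp only: hankel_integral_powr_exp)
      from sums_mult[OF this, of "1 / (2 * of_real pi * \<i>)"] show ?case
        by (simp add: G_def mult.assoc)
    qed
  qed
  with rGamma_has_fps_expansion_Gamma_coeff have "Abs_fps (\<lambda>m. Gamma_coeff n m / fact m) = G"
    by (rule fps_expansion_unique_complex)
  then have "fps_nth (Abs_fps (\<lambda>m. Gamma_coeff n m / fact m)) m = fps_nth G m"
    by (rule arg_cong)
  then have "Gamma_coeff n m / fact m =
      1 / (2 * of_real pi * \<i>) * hankel_integral (log_power_exp n m) / fact m"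
    by (simp add: G_def)
  then show ?thesis
    by (simp only: divide_cancel_right fact_nonzero) simp
qed

text \<open>
  The integrand decays at every rate below 1, in particular at the rate \<open>(1 + b) / 2 > b\<close>; the
  difference of the two rates pays for the tail estimate.
\<close>

lemma hankel_trunc_error:
  assumes "n > 0" "0 \<le> b" "b < 1"
  obtains K where "\<And>R. R > 0 \<Longrightarrow>
    norm (1 / (2 * of_real pi * \<i>) * contour_integral (hankel_trunc R) (log_power_exp n m) - Gamma_coeff n m)
      \<le> K * exp (- b * R)"
proof -
  define a where "a = (1 + b) / 2"
  have a: "b < a" "a < 1" using assms by (simp_all add: a_def)
  obtain C where C: "\<And>m s. norm (log_power_exp n m (hankel s)) \<le> fact m * C * exp (- a * \<bar>s\<bar>)"
    by (rule log_power_exp_hankel_decay[OF a(2)]) auto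
  obtain K where K: "K \<ge> 0" "\<And>r. r \<ge> 0 \<Longrightarrow>
      norm (integral {-r..r} (hankel_integrand (log_power_exp n m)) - hankel_integral (log_power_exp n m)) \<le> K * exp (- b * r)"
    by (rule hankel_integral_tail[OF continuous_on_log_power_exp \<open>0 \<le> b\<close> a(1) C]) auto
  show ?thesis
  proof
    fix R :: real assume R: "R > 0"
    let ?J = "contour_integral (hankel_trunc R) (log_power_exp n m) - hankel_integral (log_power_exp n m)"
    have "norm ?J \<le> K * exp (- b * (pi / 2 + R))"
      using K(2)[of "pi / 2 + R"] R
      by (simp only: contour_integral_hankel_trunc[OF continuous_on_log_power_exp R]) simp
    also have "\<dots> \<le> K * exp (- b * R)"
      using K(1) \<open>0 \<le> b\<close> pi_gt_zero by (intro mult_left_mono) (auto intro!: mult_left_mono)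
    finally have "norm (1 / (2 * of_real pi * \<i>)) * norm ?J \<le> norm (1 / (2 * complex_of_real pi * \<i>)) * (K * exp (- b * R))"
      by (rule mult_left_mono) simp
    then show "norm (1 / (2 * of_real pi * \<i>) * contour_integral (hankel_trunc R) (log_power_exp n m) - Gamma_coeff n m)
        \<le> (norm (1 / (2 * complex_of_real pi * \<i>)) * K) * exp (- b * R)"
      unfolding hankel_integral_log_power_exp[OF \<open>n > 0\<close>, symmetric] right_diff_distrib [symmetric] norm_mult mult.assoc .
  qed
qed

section \<open>Rationality over the zeta values\<close>

text \<open>
  The operations are those that occur in the formula for the coefficients. Subsets of the reals
  are used because all terms of that formula are real, so the embedding into the complex numbers
  is applied only once, at the end.
\<close>

definition rat_subalgebra :: "real set \<Rightarrow> bool"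
  where "rat_subalgebra L \<longleftrightarrow> \<rat> \<subseteq> L \<and> (\<forall>a\<in>L. \<forall>b\<in>L. a + b \<in> L \<and> a * b \<in> L)"

lemma rat_subalgebra_intros:
  assumes "rat_subalgebra L"
  shows "a \<in> \<rat> \<Longrightarrow> a \<in> L" "a \<in> L \<Longrightarrow> b \<in> L \<Longrightarrow> a + b \<in> L" "a \<in> L \<Longrightarrow> b \<in> L \<Longrightarrow> a * b \<in> L"
  using assms by (auto simp: rat_subalgebra_def)

lemma rat_subalgebra_sum:
  assumes "rat_subalgebra L" "\<And>i. i \<in> I \<Longrightarrow> f i \<in> L"
  shows "sum f I \<in> L"
  using assms(2)
  by (induction I rule: infinite_finite_induct) (auto intro: rat_subalgebra_intros[OF assms(1)])

lemma rat_subalgebra_power: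
  assumes "rat_subalgebra L" "a \<in> L"
  shows "a ^ n \<in> L"
  by (induction n) (auto intro: rat_subalgebra_intros[OF assms(1)] assms(2))

lemma rat_subalgebra_bell_Y:
  assumes L: "rat_subalgebra L" and "\<And>i. 1 \<le> i \<Longrightarrow> i \<le> n \<Longrightarrow> x i \<in> L"
  shows "bell_Y n x \<in> L"
  using assms(2)
proof (induction n rule: less_induct)
  case (less n)
  show ?case
  proof (cases n)
    case 0
    then show ?thesis by (simp add: rat_subalgebra_intros[OF L])
  next
    case (Suc n')
    show ?thesis
      unfolding Suc bell_Y_Suc using less Suc
      by (intro rat_subalgebra_sum[OF L] rat_subalgebra_intros(3)[OF L]) (auto intro: rat_subalgebra_intros[OF L])
  qed
qed

lemma rat_subalgebra_rat_adjoin: "rat_subalgebra {r. complex_of_real r \<in> rat_adjoin S}"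
proof -
  note intros = generate_field.intros[where R = "ring_of_type_algebra :: complex ring" and H = "\<rat> \<union> S"]
  have "complex_of_real r \<in> rat_adjoin S" if "r \<in> \<rat>" for r
    unfolding rat_adjoin_def using that by (intro intros(2)) auto
  moreover have "x + y \<in> rat_adjoin S" "x * y \<in> rat_adjoin S" if "x \<in> rat_adjoin S" "y \<in> rat_adjoin S" for x y
    using intros(5)[of x y] intros(6)[of x y] that
    unfolding rat_adjoin_def by (simp_all add: ring_of_type_algebra_def)
  ultimately show ?thesis
    by (auto simp: rat_subalgebra_def)
qed

lemma zeta_val_2: "zeta_val 2 = pi ^ 2 / 6"
  using inverse_squares_sums by (simp add: zeta_val_def sums_iff add.commute)

text \<open>
  In the formula for the coefficient, \<open>i\<close> is odd and hence at least 1, so \<open>j < m\<close> and the Bell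
  polynomial involves only \<open>\<zeta>(n)\<close> with \<open>n < m\<close>. The exponent \<open>i - 1\<close> of \<open>pi\<close> is even. It is
  positive only if \<open>i \<ge> 3\<close>, and then \<open>m > 2\<close> makes \<open>\<zeta>(2) = pi^2 / 6\<close> one of the generators.
\<close>

lemma Gamma_coeff_in_rat_adjoin:
  "Gamma_coeff (N + 1) m \<in> rat_adjoin ((\<lambda>n. complex_of_real (zeta_val n)) ` {1..<m})"
proof -
  define L where "L = {r. complex_of_real r \<in> rat_adjoin ((\<lambda>n. complex_of_real (zeta_val n)) ` {1..<m})}"
  have L: "rat_subalgebra L"
    unfolding L_def by (rule rat_subalgebra_rat_adjoin)
  note intros = rat_subalgebra_intros[OF L]
  have zeta: "zeta_val n \<in> L" if "1 \<le> n" "n < m" for n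
    unfolding L_def rat_adjoin_def mem_Collect_eq using that by (intro generate_field.incl) auto
  have fact_Rats: "(fact n :: real) \<in> \<rat>" for n
    using Rats_of_nat[of "fact n"] by simp
  have sign_Rats: "(- 1 :: real) ^ n \<in> \<rat>" for n
    by (intro Rats_power) simp
  have pi_power: "pi ^ (i - 1) \<in> L" if i: "odd i" "i \<le> m" for i
  proof (cases "i = 1")
    case False
    with i have "2 < m" by (auto elim!: oddE)
    then have "6 * zeta_val 2 \<in> L" by (intro intros(3)[OF intros(1)] zeta) auto
    then have "pi ^ 2 \<in> L" by (simp add: zeta_val_2)
    then have "(pi ^ 2) ^ ((i - 1) div 2) \<in> L" by (rule rat_subalgebra_power[OF L])
    with i show ?thesis by (simp flip: power_mult)
  qed (simp add: intros)
  have bell: "bell_Y j (\<lambda>n. fact (n - 1) * (- 1) ^ n * zeta_val n) \<in> L" if "j < m" for j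
    using that
    by (intro rat_subalgebra_bell_Y[OF L] intros(3)[OF intros(1)] zeta Rats_mult fact_Rats sign_Rats) auto
  have "(- 1) ^ N *
          (\<Sum>(i, j, k) \<in> {(i, j, k). i + j + k = m \<and> odd i}.
             (- 1) ^ ((i - 1) div 2) * fact k * (fact m / (fact i * fact j * fact k)) *
             pi ^ (i - 1) *
             bell_Y j (\<lambda>n. fact (n - 1) * (- 1) ^ n * zeta_val n) *
             real (stirling (N + 2) (k + 1))) \<in> L"
  proof (intro intros(3) rat_subalgebra_sum[OF L])
    show "(- 1) ^ N \<in> L" by (rule intros(1)[OF sign_Rats])
    fix p assume p: "p \<in> {(i, j, k). i + j + k = m \<and> odd i}"
    then obtain i j k where ijk: "p = (i, j, k)" "i + j + k = m" "odd i" by auto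
    then have "i \<le> m" "j < m" by (auto elim!: oddE)
    have "(- 1) ^ ((i - 1) div 2) * fact k * (fact m / (fact i * fact j * fact k)) \<in> (\<rat> :: real set)"
      by (intro Rats_mult Rats_divide sign_Rats fact_Rats)
    then show "(case p of (i, j, k) \<Rightarrow> (- 1) ^ ((i - 1) div 2) * fact k * (fact m / (fact i * fact j * fact k)) *
             pi ^ (i - 1) *
             bell_Y j (\<lambda>n. fact (n - 1) * (- 1) ^ n * zeta_val n) *
             real (stirling (N + 2) (k + 1))) \<in> L"
      unfolding ijk(1) prod.case
      by (intro intros(3)[OF intros(3)[OF intros(3)]] pi_power bell ijk \<open>i \<le> m\<close> \<open>j < m\<close>)
         (simp_all only: intros(1) Rats_of_nat)
  qed
  then show ?thesis
    unfolding Gamma_coeff_eq_sum by (simp add: L_def)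
qed

section \<open>The Hankel integrals and their values\<close>

theorem lemma2p2:
  fixes N m :: nat
  shows
    "((deriv ^^ m) (\<lambda>z. 1 / Gamma (- z)) \<longlongrightarrow> Gamma_coeff (N + 1) m) (at (of_nat (N + 1)))
     \<and> hankel_integrable (\<lambda>w. Ln w ^ m * w ^ (N + 1) * exp w)
     \<and> 1 / (2 * of_real pi * \<i>) * hankel_integral (\<lambda>w. Ln w ^ m * w ^ (N + 1) * exp w)
         = Gamma_coeff (N + 1) m
     \<and> Gamma_coeff (N + 1) m = complex_of_real
         ((- 1) ^ N *
          (\<Sum>(i, j, k) \<in> {(i, j, k). i + j + k = m \<and> odd i}.
             (- 1) ^ ((i - 1) div 2) * fact k * (fact m / (fact i * fact j * fact k)) *
             pi ^ (i - 1) *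
             bell_Y j (\<lambda>n. fact (n - 1) * (- 1) ^ n * zeta_val n) *
             real (stirling (N + 2) (k + 1))))
     \<and> (\<forall>c c'. 0 < c' \<and> c' < c \<longrightarrow>
          (\<exists>K. \<forall>T :: real \<Rightarrow> real.
             (\<forall>x\<ge>1.9. T x > 1) \<and> filterlim (\<lambda>x. ln x / ln (T x)) at_top at_top \<longrightarrow>
             (\<forall>x\<ge>1.9.
                norm (1 / (2 * of_real pi * \<i>) *
                        contour_integral (hankel_trunc (c * ln x / ln (T x)))
                          (\<lambda>w. Ln w ^ m * w ^ (N + 1) * exp w)
                      - Gamma_coeff (N + 1) m)
                \<le> K * exp (- c' * ln x / ln (T x)))))
     \<and> (N \<ge> 1 \<longrightarrow>
          Gamma_coeff N m \<in> rat_adjoin ((\<lambda>n. complex_of_real (zeta_val n)) ` {1..<m}))"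
  unfolding log_power_exp_def [symmetric]
proof (intro conjI allI impI)
  show "((deriv ^^ m) (\<lambda>z. 1 / Gamma (- z)) \<longlongrightarrow> Gamma_coeff (N + 1) m) (at (of_nat (N + 1)))"
    by (rule tendsto_Gamma_coeff)
  show "hankel_integrable (log_power_exp (N + 1) m)"
    by (rule hankel_integrable_log_power_exp)
  show "1 / (2 * of_real pi * \<i>) * hankel_integral (log_power_exp (N + 1) m) = Gamma_coeff (N + 1) m"
    by (rule hankel_integral_log_power_exp) simp
  show "Gamma_coeff (N + 1) m = complex_of_real
         ((- 1) ^ N *
          (\<Sum>(i, j, k) \<in> {(i, j, k). i + j + k = m \<and> odd i}.
             (- 1) ^ ((i - 1) div 2) * fact k * (fact m / (fact i * fact j * fact k)) *
             pi ^ (i - 1) *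
             bell_Y j (\<lambda>n. fact (n - 1) * (- 1) ^ n * zeta_val n) *
             real (stirling (N + 2) (k + 1))))"
    by (rule Gamma_coeff_eq_sum)
next
  fix c c' :: real
  assume c: "0 < c' \<and> c' < c"
  \<comment> \<open>With \<open>R = c * ln x / ln (T x)\<close>, decay at the rate \<open>c' / c\<close> in \<open>R\<close> is the claimed error term. The constant
    is uniform in \<open>R\<close> and therefore the same for all \<open>T\<close>.\<close>
  obtain K where K: "\<And>R. R > 0 \<Longrightarrow> norm (1 / (2 * of_real pi * \<i>) *
      contour_integral (hankel_trunc R) (log_power_exp (N + 1) m) - Gamma_coeff (N + 1) m) \<le> K * exp (- (c' / c) * R)"
    by (rule hankel_trunc_error[of "N + 1" "c' / c" m]) (use c in auto)
  show "\<exists>K. \<forall>T :: real \<Rightarrow> real.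
             (\<forall>x\<ge>1.9. T x > 1) \<and> filterlim (\<lambda>x. ln x / ln (T x)) at_top at_top \<longrightarrow>
             (\<forall>x\<ge>1.9.
                norm (1 / (2 * of_real pi * \<i>) *
                        contour_integral (hankel_trunc (c * ln x / ln (T x))) (log_power_exp (N + 1) m)
                      - Gamma_coeff (N + 1) m)
                \<le> K * exp (- c' * ln x / ln (T x)))"
  proof (intro exI[of _ K] allI impI)
    fix T :: "real \<Rightarrow> real" and x :: real
    assume "(\<forall>x\<ge>1.9. T x > 1) \<and> filterlim (\<lambda>x. ln x / ln (T x)) at_top at_top" "x \<ge> 1.9"
    then have "ln x > 0" "ln (T x) > 0" by auto
    then have "c * ln x / ln (T x) > 0" using c by simp
    moreover have "- (c' / c) * (c * ln x / ln (T x)) = - c' * ln x / ln (T x)" using c by simp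
    ultimately show "norm (1 / (2 * of_real pi * \<i>) *
                        contour_integral (hankel_trunc (c * ln x / ln (T x))) (log_power_exp (N + 1) m)
                      - Gamma_coeff (N + 1) m)
                \<le> K * exp (- c' * ln x / ln (T x))"
      using K by metis
  qed
next
  assume "N \<ge> 1"
  then obtain N' where "N = N' + 1" by (metis le_add_diff_inverse2)
  then show "Gamma_coeff N m \<in> rat_adjoin ((\<lambda>n. complex_of_real (zeta_val n)) ` {1..<m})"
    using Gamma_coeff_in_rat_adjoin by simp
qed

end
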